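(* There is an isomorphism of associative algebras $H\cong H_{\mathbf 1}$.
   Context: $\bar S_2$ is the complex Lie algebra of polynomial vector fields $p_1\partial_1+p_2\partial_2$, $p_i\in\mathbb C[t_1,t_2]$, $\partial_i=\partial/\partial t_i$, with constant divergence $\partial_1(p_1)+\partial_2(p_2)\in\mathbb C$; $d_i=t_i\partial_i$. The set $\{\partial_1^{i_1}\partial_2^{i_2}\mid i_1,i_2\in\mathbb Z_+\}$ is an Ore subset of $U(\bar S_2)$; $U_{(-1)}$ is the localization of $U(\bar S_2)$ at this set, and $$H=\{u\in U_{(-1)}\mid[u,\partial_i]=[u,d_i]=0,\ i=1,2\},$$ a subalgebra of $U_{(-1)}$. Let $\Delta_2=\mathrm{span}\{\partial_1,\partial_2\}$, let $\mathbb C_{\mathbf 1}=\mathbb Cv_{\mathbf 1}$ be the one-dimensional $U(\Delta_2)$-module with $\partial_iv_{\mathbf 1}=v_{\mathbf 1}$ ($i=1,2$), $Q_{\mathbf 1}=U(\bar S_2)\otimes_{U(\Delta_2)}\mathbb C_{\mathbf 1}$ the induced $\bar S_2$-module, and $H_{\mathbf 1}=\mathrm{End}_{\bar S_2}(Q_{\mathbf 1})^{\mathrm{op}}$. *)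

theory Defs
  imports
    "HOL-Library.Poly_Mapping"
    "HOL-Computational_Algebra.Polynomial"
    "HOL-Algebra.QuotRing"
    "HOL-Algebra.Module"
    Complex_Main
begin

section \<open>Complex vector spaces, associative algebras and Lie algebras\<close>

class scaleC =
  fixes scaleC :: "complex \<Rightarrow> 'a \<Rightarrow> 'a" (infixr \<open>*\<^sub>C\<close> 75)

class complex_vector = scaleC + ab_group_add +
  assumes scaleC_add_right: "c *\<^sub>C (x + y) = c *\<^sub>C x + c *\<^sub>C y"
    and scaleC_add_left: "(c + d) *\<^sub>C x = c *\<^sub>C x + d *\<^sub>C x"
    and scaleC_scaleC: "c *\<^sub>C (d *\<^sub>C x) = (c * d) *\<^sub>C x"
    and scaleC_one: "1 *\<^sub>C x = x"

class complex_algebra_1 = complex_vector + ring_1 +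
  assumes mult_scaleC_left: "(c *\<^sub>C x) * y = c *\<^sub>C (x * y)"
    and mult_scaleC_right: "x * (c *\<^sub>C y) = c *\<^sub>C (x * y)"

class complex_lie_algebra = complex_vector +
  fixes lie :: "'a \<Rightarrow> 'a \<Rightarrow> 'a"
  assumes lie_add_left: "lie (x + y) z = lie x z + lie y z"
    and lie_add_right: "lie x (y + z) = lie x y + lie x z"
    and lie_scaleC_left: "lie (c *\<^sub>C x) y = c *\<^sub>C lie x y"
    and lie_scaleC_right: "lie x (c *\<^sub>C y) = c *\<^sub>C lie x y"
    and lie_self: "lie x x = 0"
    and lie_jacobi: "lie x (lie y z) + lie y (lie z x) + lie z (lie x y) = 0"

lemma scaleC_zero_right [simp]: "c *\<^sub>C (0::'a::complex_vector) = 0"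
  using scaleC_add_right[of c "0::'a" 0] by simp

lemma scaleC_zero_left [simp]: "0 *\<^sub>C (x::'a::complex_vector) = 0"
  using scaleC_add_left[of 0 0 x] by simp

instantiation complex :: complex_algebra_1
begin
definition scaleC_complex :: "complex \<Rightarrow> complex \<Rightarrow> complex" where "scaleC_complex c x = c * x"
instance by standard (simp_all add: scaleC_complex_def algebra_simps)
end


section \<open>The free associative algebra and the universal enveloping algebra\<close>

datatype 'a free_monoid = Word (letters: "'a list")

instantiation free_monoid :: (type) monoid_add
begin
definition zero_free_monoid :: "'a free_monoid" where "0 = Word []"
definition plus_free_monoid :: "'a free_monoid \<Rightarrow> 'a free_monoid \<Rightarrow> 'a free_monoid"
  where "v + w = Word (letters v @ letters w)"
instance by standard (simp_all add: zero_free_monoid_def plus_free_monoid_def)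
end

text \<open>With its convolution product, \<open>'a free_monoid \<Rightarrow>\<^sub>0 complex\<close> is the free associative
  algebra on the set of all elements of type \<open>'a\<close>.\<close>

definition free_gen :: "'a \<Rightarrow> ('a free_monoid \<Rightarrow>\<^sub>0 complex)"
  where "free_gen x = Poly_Mapping.single (Word [x]) 1"

definition free_const :: "complex \<Rightarrow> ('a free_monoid \<Rightarrow>\<^sub>0 complex)"
  where "free_const c = Poly_Mapping.single 0 c"

definition free_eval :: "('a \<Rightarrow> 'b::complex_algebra_1) \<Rightarrow> ('a free_monoid \<Rightarrow>\<^sub>0 complex) \<Rightarrow> 'b"
  where "free_eval f p =
    (\<Sum>w\<in>Poly_Mapping.keys p. Poly_Mapping.lookup p w *\<^sub>C prod_list (map f (letters w)))"

text \<open>The two-sided ideal cutting out the enveloping algebra. As the free algebra is taken on the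
  underlying set of the Lie algebra, the first two kinds of generators produce the tensor algebra.\<close>

inductive_set uea_ideal :: "('g::complex_lie_algebra free_monoid \<Rightarrow>\<^sub>0 complex) set" where
  add_gen: "free_gen (x + y) - free_gen x - free_gen y \<in> uea_ideal"
| scale_gen: "free_gen (c *\<^sub>C x) - free_const c * free_gen x \<in> uea_ideal"
| lie_gen: "free_gen x * free_gen y - free_gen y * free_gen x - free_gen (lie x y) \<in> uea_ideal"
| add: "p \<in> uea_ideal \<Longrightarrow> q \<in> uea_ideal \<Longrightarrow> p + q \<in> uea_ideal"
| mult_left: "p \<in> uea_ideal \<Longrightarrow> r * p \<in> uea_ideal"
| mult_right: "p \<in> uea_ideal \<Longrightarrow> p * r \<in> uea_ideal"

lemma uea_ideal_zero: "0 \<in> uea_ideal"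
  using uea_ideal.mult_left[OF uea_ideal.add_gen, of 0] by simp

lemma uea_ideal_uminus: "p \<in> uea_ideal \<Longrightarrow> - p \<in> uea_ideal"
  using uea_ideal.mult_left[of p "-1"] by simp

lemma uea_ideal_diff: "p \<in> uea_ideal \<Longrightarrow> q \<in> uea_ideal \<Longrightarrow> p - q \<in> uea_ideal"
  using uea_ideal.add[OF _ uea_ideal_uminus] by fastforce

lemma free_eval_superset:
  assumes "finite A" "Poly_Mapping.keys p \<subseteq> A"
  shows "free_eval f p = (\<Sum>w\<in>A. Poly_Mapping.lookup p w *\<^sub>C prod_list (map f (letters w)))"
  unfolding free_eval_def using assms
  by (intro sum.mono_neutral_left) (auto simp: in_keys_iff)

lemma free_eval_add: "free_eval f (p + q) = free_eval f p + free_eval f q"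
proof -
  let ?A = "Poly_Mapping.keys p \<union> Poly_Mapping.keys q"
  have "Poly_Mapping.keys (p + q) \<subseteq> ?A" by (rule Poly_Mapping.keys_add)
  then show ?thesis
    by (simp add: free_eval_superset[of ?A] lookup_add scaleC_add_left sum.distrib)
qed

lemma free_eval_zero [simp]: "free_eval f 0 = 0"
  by (simp add: free_eval_def)

lemma free_eval_uminus: "free_eval f (- p) = - free_eval f p"
  using free_eval_add[of f p "- p"] by (simp add: eq_neg_iff_add_eq_0 add.commute)

lemma free_eval_diff: "free_eval f (p - q) = free_eval f p - free_eval f q"
  using free_eval_add[of f p "- q"] by (simp add: free_eval_uminus)

lemma free_eval_single [simp]:
  "free_eval f (Poly_Mapping.single w c) = c *\<^sub>C prod_list (map f (letters w))"
  by (cases "c = 0") (simp_all add: free_eval_def)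

lemma poly_mapping_single_add_induct [case_names zero single_add]:
  fixes P :: "('a \<Rightarrow>\<^sub>0 'b::ab_group_add) \<Rightarrow> bool"
  assumes "P 0" and step: "\<And>w c p. P p \<Longrightarrow> P (Poly_Mapping.single w c + p)"
  shows "P p"
proof (induction "card (Poly_Mapping.keys p)" arbitrary: p)
  case 0
  then show ?case using assms(1) by simp
next
  case (Suc n)
  then obtain w where w: "w \<in> Poly_Mapping.keys p" by fastforce
  let ?q = "p - Poly_Mapping.single w (Poly_Mapping.lookup p w)"
  have "Poly_Mapping.keys ?q = Poly_Mapping.keys p - {w}"
    by (auto simp: in_keys_iff lookup_minus lookup_single when_def split: if_splits)
  then have "card (Poly_Mapping.keys ?q) = n" using Suc(2) w by simp
  then have "P ?q" using Suc(1) by simp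
  from step[OF this, of w "Poly_Mapping.lookup p w"] show ?case by simp
qed

lemma free_eval_mult: "free_eval f (p * q) = free_eval f p * free_eval f q"
proof (induction p rule: poly_mapping_single_add_induct)
  case zero
  show ?case by simp
next
  case (single_add w c p)
  have "free_eval f (Poly_Mapping.single w c * q)
      = free_eval f (Poly_Mapping.single w c) * free_eval f q"
  proof (induction q rule: poly_mapping_single_add_induct)
    case zero
    show ?case by simp
  next
    case (single_add v d q)
    then show ?case
      by (simp add: distrib_left free_eval_add mult_single plus_free_monoid_def
          mult_scaleC_left mult_scaleC_right scaleC_scaleC mult.commute[of c])
  qed
  with single_add show ?case by (simp add: distrib_right free_eval_add)
qed

lemma free_eval_gen [simp]: "free_eval f (free_gen x) = f x"
  by (simp add: free_gen_def scaleC_one)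

lemma free_eval_const [simp]: "free_eval f (free_const c) = c *\<^sub>C 1"
  by (simp add: free_const_def zero_free_monoid_def)

lemma free_const_one: "free_const 1 = 1"
  by (simp add: free_const_def)

lemma free_eval_one [simp]: "free_eval f 1 = 1"
  using free_eval_const[of f 1] by (simp add: free_const_one scaleC_one)

definition lie_to_assoc_hom :: "('g::complex_lie_algebra \<Rightarrow> 'b::complex_algebra_1) \<Rightarrow> bool"
  where "lie_to_assoc_hom f \<longleftrightarrow> (\<forall>x y. f (x + y) = f x + f y) \<and> (\<forall>c x. f (c *\<^sub>C x) = c *\<^sub>C f x) \<and>
    (\<forall>x y. f (lie x y) = f x * f y - f y * f x)"

lemma free_eval_uea_ideal:
  assumes "lie_to_assoc_hom f" "p \<in> uea_ideal"
  shows "free_eval f p = 0"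
  using assms(2)
  by induction (use assms(1) in \<open>simp_all add: lie_to_assoc_hom_def free_eval_diff free_eval_add
    free_eval_mult mult_scaleC_left\<close>)

quotient_type (overloaded) 'g uea = "'g::complex_lie_algebra free_monoid \<Rightarrow>\<^sub>0 complex"
  / "\<lambda>p q. p - q \<in> uea_ideal"
proof (rule equivpI)
  show "reflp (\<lambda>p q. p - q \<in> uea_ideal)"
    by (rule reflpI) (simp add: uea_ideal_zero)
  show "symp (\<lambda>p q. p - q \<in> uea_ideal)"
    by (rule sympI) (drule uea_ideal_uminus, simp)
  show "transp (\<lambda>p q. p - q \<in> uea_ideal)"
    by (rule transpI) (drule (1) uea_ideal.add, simp)
qed

instantiation uea :: (complex_lie_algebra) complex_algebra_1
begin

lift_definition zero_uea :: "'a uea" is 0 .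
lift_definition one_uea :: "'a uea" is 1 .
lift_definition plus_uea :: "'a uea \<Rightarrow> 'a uea \<Rightarrow> 'a uea" is "(+)"
proof -
  fix p q r s :: "'a free_monoid \<Rightarrow>\<^sub>0 complex"
  assume "p - q \<in> uea_ideal" "r - s \<in> uea_ideal"
  from uea_ideal.add[OF this] show "p + r - (q + s) \<in> uea_ideal" by (simp add: algebra_simps)
qed
lift_definition uminus_uea :: "'a uea \<Rightarrow> 'a uea" is uminus
  by (drule uea_ideal_uminus) (simp add: algebra_simps)
lift_definition minus_uea :: "'a uea \<Rightarrow> 'a uea \<Rightarrow> 'a uea" is "(-)"
proof -
  fix p q r s :: "'a free_monoid \<Rightarrow>\<^sub>0 complex"
  assume "p - q \<in> uea_ideal" "r - s \<in> uea_ideal"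
  from uea_ideal_diff[OF this] show "p - r - (q - s) \<in> uea_ideal" by (simp add: algebra_simps)
qed
lift_definition times_uea :: "'a uea \<Rightarrow> 'a uea \<Rightarrow> 'a uea" is "(*)"
proof -
  fix p q r s :: "'a free_monoid \<Rightarrow>\<^sub>0 complex"
  assume *: "p - q \<in> uea_ideal" "r - s \<in> uea_ideal"
  have "(p - q) * r + q * (r - s) \<in> uea_ideal"
    using * by (intro uea_ideal.add uea_ideal.mult_left uea_ideal.mult_right)
  then show "p * r - q * s \<in> uea_ideal" by (simp add: algebra_simps)
qed
lift_definition scaleC_uea :: "complex \<Rightarrow> 'a uea \<Rightarrow> 'a uea" is "\<lambda>c p. free_const c * p"
  by (simp add: uea_ideal.mult_left flip: right_diff_distrib)

lemma free_const_comm: "p * free_const c = free_const c * (p :: 'b free_monoid \<Rightarrow>\<^sub>0 complex)"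
  by (induction p rule: poly_mapping_single_add_induct)
    (simp_all add: free_const_def distrib_left distrib_right mult_single mult.commute)

lemma one_notin_uea_ideal: "(1 :: 'a free_monoid \<Rightarrow>\<^sub>0 complex) \<notin> uea_ideal"
proof
  assume "(1 :: 'a free_monoid \<Rightarrow>\<^sub>0 complex) \<in> uea_ideal"
  moreover have "lie_to_assoc_hom (\<lambda>x::'a. 0::complex)"
    by (simp add: lie_to_assoc_hom_def)
  ultimately have "free_eval (\<lambda>x::'a. 0::complex) 1 = 0" by (intro free_eval_uea_ideal)
  then show False by simp
qed

instance
proof
  fix a b c :: "'a uea" and z w :: complex
  show "a + b + c = a + (b + c)" by transfer (simp add: add.assoc uea_ideal_zero)
  show "a + b = b + a" by transfer (simp add: add.commute uea_ideal_zero)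
  show "0 + a = a" by transfer (simp add: uea_ideal_zero)
  show "- a + a = 0" by transfer (simp add: uea_ideal_zero)
  show "a - b = a + - b" by transfer (simp add: uea_ideal_zero)
  show "a * b * c = a * (b * c)" by transfer (simp add: mult.assoc uea_ideal_zero)
  show "1 * a = a" by transfer (simp add: uea_ideal_zero)
  show "a * 1 = a" by transfer (simp add: uea_ideal_zero)
  show "(a + b) * c = a * c + b * c" by transfer (simp add: distrib_right uea_ideal_zero)
  show "a * (b + c) = a * b + a * c" by transfer (simp add: distrib_left uea_ideal_zero)
  show "(0 :: 'a uea) \<noteq> 1"
    using one_notin_uea_ideal uea_ideal_uminus[of "- 1 :: 'a free_monoid \<Rightarrow>\<^sub>0 complex"]
    by transfer auto
  show "z *\<^sub>C (a + b) = z *\<^sub>C a + z *\<^sub>C b" by transfer (simp add: distrib_left uea_ideal_zero)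
  show "(z + w) *\<^sub>C a = z *\<^sub>C a + w *\<^sub>C a"
    by transfer (simp add: free_const_def single_add distrib_right uea_ideal_zero)
  show "z *\<^sub>C (w *\<^sub>C a) = (z * w) *\<^sub>C a"
    by transfer (simp add: free_const_def mult_single uea_ideal_zero flip: mult.assoc)
  show "1 *\<^sub>C a = a" by transfer (simp add: free_const_def uea_ideal_zero)
  show "(z *\<^sub>C a) * b = z *\<^sub>C (a * b)" by transfer (simp add: mult.assoc uea_ideal_zero)
  show "a * (z *\<^sub>C b) = z *\<^sub>C (a * b)"
    by transfer (simp add: free_const_comm uea_ideal_zero flip: mult.assoc)
qed

end

lift_definition uea_of :: "'g::complex_lie_algebra \<Rightarrow> 'g uea" is free_gen .

text \<open>The algebra homomorphism on \<open>U(g)\<close> induced by a Lie homomorphism \<open>f\<close> from \<open>g\<close> to an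
  associative algebra; for such \<open>f\<close> the choice of representative is immaterial.\<close>

definition uea_lift :: "('g::complex_lie_algebra \<Rightarrow> 'b::complex_algebra_1) \<Rightarrow> 'g uea \<Rightarrow> 'b"
  where "uea_lift f u = free_eval f (rep_uea u)"

lemma uea_lift_abs:
  assumes "lie_to_assoc_hom f"
  shows "uea_lift f (abs_uea p) = free_eval f p"
proof -
  have "rep_uea (abs_uea p) - p \<in> uea_ideal"
    by (simp add: Quotient3_abs_rep[OF Quotient3_uea] flip: uea.abs_eq_iff)
  from free_eval_uea_ideal[OF assms this] show ?thesis
    by (simp add: uea_lift_def free_eval_diff)
qed

lemma uea_lift_of: "lie_to_assoc_hom f \<Longrightarrow> uea_lift f (uea_of x) = f x"
  by (simp add: uea_of.abs_eq uea_lift_abs)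

lemma uea_lift_hom:
  assumes "lie_to_assoc_hom f"
  shows "uea_lift f (u + v) = uea_lift f u + uea_lift f v"
    and "uea_lift f (u * v) = uea_lift f u * uea_lift f v"
    and "uea_lift f (c *\<^sub>C u) = c *\<^sub>C uea_lift f u"
    and "uea_lift f 1 = 1"
proof -
  obtain p q where pq: "u = abs_uea p" "v = abs_uea q"
    using that[of "rep_uea u" "rep_uea v"] by (simp add: Quotient3_abs_rep[OF Quotient3_uea])
  show "uea_lift f (u + v) = uea_lift f u + uea_lift f v"
    and "uea_lift f (u * v) = uea_lift f u * uea_lift f v"
    and "uea_lift f (c *\<^sub>C u) = c *\<^sub>C uea_lift f u"
    by (simp_all add: pq plus_uea.abs_eq times_uea.abs_eq scaleC_uea.abs_eq uea_lift_abs[OF assms]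
        free_eval_add free_eval_mult mult_scaleC_left)
  show "uea_lift f 1 = 1"
    by (simp add: one_uea_def uea_lift_abs[OF assms])
qed

lemma lie_to_assoc_hom_uea_of: "lie_to_assoc_hom uea_of"
proof -
  have "uea_of (x + y) = uea_of x + uea_of y" for x y :: 'a
    by transfer (simp add: uea_ideal.add_gen flip: diff_diff_eq)
  moreover have "uea_of (c *\<^sub>C x) = c *\<^sub>C uea_of x" for c and x :: 'a
    by transfer (rule uea_ideal.scale_gen)
  moreover have "uea_of (lie x y) = uea_of x * uea_of y - uea_of y * uea_of x" for x y :: 'a
  proof transfer
    fix x y :: 'a
    show "free_gen (lie x y) - (free_gen x * free_gen y - free_gen y * free_gen x) \<in> uea_ideal"
      using uea_ideal_uminus[OF uea_ideal.lie_gen[of x y]] by simp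
  qed
  ultimately show ?thesis by (simp add: lie_to_assoc_hom_def)
qed


section \<open>Polynomial vector fields in two variables with constant divergence\<close>

text \<open>\<open>\<complex>[t\<^sub>1, t\<^sub>2]\<close> is rendered as \<open>\<complex>[t\<^sub>1][t\<^sub>2]\<close>: the inner variable is \<open>t\<^sub>1\<close>, the outer one \<open>t\<^sub>2\<close>.\<close>

type_synonym cpoly2 = "complex poly poly"

definition pd1 :: "cpoly2 \<Rightarrow> cpoly2" where "pd1 = map_poly pderiv"
definition pd2 :: "cpoly2 \<Rightarrow> cpoly2" where "pd2 = pderiv"

definition t1 :: cpoly2 where "t1 = [:[:0, 1:]:]"
definition t2 :: cpoly2 where "t2 = [:0, 1:]"

lemma coeff_pd1: "coeff (pd1 p) n = pderiv (coeff p n)"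
  by (simp add: pd1_def coeff_map_poly)

lemma pd1_add: "pd1 (p + q) = pd1 p + pd1 q"
  by (rule poly_eqI) (simp add: coeff_pd1 pderiv_add)
lemma pd1_diff: "pd1 (p - q) = pd1 p - pd1 q"
  by (rule poly_eqI) (simp add: coeff_pd1 pderiv_diff)
lemma pd1_minus: "pd1 (- p) = - pd1 p"
  by (rule poly_eqI) (simp add: coeff_pd1 pderiv_minus)
lemma pderiv_sum': "pderiv (\<Sum>i\<in>A. f i) = (\<Sum>i\<in>A. pderiv (f i))"
  by (induction A rule: infinite_finite_induct) (simp_all add: pderiv_add)
lemma pd1_mult: "pd1 (p * q) = p * pd1 q + q * pd1 p"
proof (rule poly_eqI)
  fix n
  have "coeff (pd1 (p * q)) n
      = coeff (p * pd1 q) n + (\<Sum>i\<le>n. coeff q (n - i) * pderiv (coeff p i))"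
    by (simp add: coeff_pd1 coeff_mult pderiv_sum' pderiv_mult sum.distrib)
  also have "(\<Sum>i\<le>n. coeff q (n - i) * pderiv (coeff p i)) = coeff (pd1 p * q) n"
    unfolding coeff_mult coeff_pd1 by (rule sum.cong) (simp_all add: mult.commute)
  finally show "coeff (pd1 (p * q)) n = coeff (p * pd1 q + q * pd1 p) n"
    by (simp add: mult.commute)
qed
lemma pd2_add: "pd2 (p + q) = pd2 p + pd2 q" by (simp add: pd2_def pderiv_add)
lemma pd2_diff: "pd2 (p - q) = pd2 p - pd2 q" by (simp add: pd2_def pderiv_diff)
lemma pd2_minus: "pd2 (- p) = - pd2 p" by (simp add: pd2_def pderiv_minus)
lemma pd2_mult: "pd2 (p * q) = p * pd2 q + q * pd2 p" by (simp add: pd2_def pderiv_mult)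
lemma pd1_smult: "pd1 (Polynomial.smult [:c:] p) = Polynomial.smult [:c:] (pd1 p)"
  by (rule poly_eqI) (simp add: coeff_pd1 pderiv_smult)
lemma pd2_smult: "pd2 (Polynomial.smult c p) = Polynomial.smult c (pd2 p)"
  by (simp add: pd2_def pderiv_smult)
lemma pd1_pd2: "pd1 (pd2 p) = pd2 (pd1 p)"
  by (rule poly_eqI) (simp add: coeff_pd1 pd2_def coeff_pderiv pderiv_mult pderiv_add pderiv_of_nat)
lemma pd_const [simp]: "pd1 [:[:c:]:] = 0" "pd2 [:[:c:]:] = 0"
proof -
  show "pd1 [:[:c:]:] = 0"
    by (rule poly_eqI) (simp add: coeff_pd1 coeff_pCons split: nat.split)
  show "pd2 [:[:c:]:] = 0" by (simp add: pd2_def pderiv_pCons)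
qed
lemma pd_t [simp]: "pd1 t1 = 1" "pd2 t2 = 1"
proof -
  show "pd1 t1 = 1"
    by (rule poly_eqI) (simp add: coeff_pd1 t1_def coeff_pCons pderiv_pCons split: nat.split)
  show "pd2 t2 = 1" by (simp add: pd2_def t2_def pderiv_pCons)
qed
lemma pd_zero [simp]: "pd1 0 = 0" "pd2 0 = 0"
  by (simp_all add: pd1_def pd2_def)
lemma pd_one [simp]: "pd1 1 = 0" "pd2 1 = 0"
  using pd_const[of 1] by (simp_all flip: one_pCons)

lemmas pd_simps = pd1_add pd1_diff pd1_minus pd1_mult pd2_add pd2_diff pd2_minus pd2_mult
  pd1_smult pd2_smult pd1_pd2

text \<open>The pair \<open>(p\<^sub>1, p\<^sub>2)\<close> stands for the vector field \<open>p\<^sub>1 \<partial>\<^sub>1 + p\<^sub>2 \<partial>\<^sub>2\<close>.\<close>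

typedef sbar2 = "{(p1 :: cpoly2, p2 :: cpoly2). \<exists>c. pd1 p1 + pd2 p2 = [:[:c:]:]}"
  morphisms components vfield
  by (rule exI[of _ "(0, 0)"]) (auto intro!: exI[of _ 0])

setup_lifting type_definition_sbar2

instantiation sbar2 :: complex_lie_algebra
begin

lift_definition zero_sbar2 :: sbar2 is "(0, 0)"
  by (auto intro!: exI[of _ 0])
lift_definition plus_sbar2 :: "sbar2 \<Rightarrow> sbar2 \<Rightarrow> sbar2"
  is "\<lambda>(p1, p2) (q1, q2). (p1 + q1, p2 + q2)"
proof clarsimp
  fix p1 p2 q1 q2 :: cpoly2 and c d
  assume "pd1 p1 + pd2 p2 = [:[:c:]:]" "pd1 q1 + pd2 q2 = [:[:d:]:]"
  moreover have "pd1 (p1 + q1) + pd2 (p2 + q2) = (pd1 p1 + pd2 p2) + (pd1 q1 + pd2 q2)"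
    by (simp add: pd_simps algebra_simps)
  ultimately show "\<exists>c. pd1 (p1 + q1) + pd2 (p2 + q2) = [:[:c:]:]" by simp
qed
lift_definition uminus_sbar2 :: "sbar2 \<Rightarrow> sbar2" is "\<lambda>(p1, p2). (- p1, - p2)"
proof clarsimp
  fix p1 p2 :: cpoly2 and c
  assume "pd1 p1 + pd2 p2 = [:[:c:]:]"
  moreover have "pd1 (- p1) + pd2 (- p2) = - (pd1 p1 + pd2 p2)"
    by (simp add: pd_simps)
  ultimately show "\<exists>c. pd1 (- p1) + pd2 (- p2) = [:[:c:]:]" by simp
qed
definition minus_sbar2 :: "sbar2 \<Rightarrow> sbar2 \<Rightarrow> sbar2" where "minus_sbar2 x y = x + - y"
lift_definition scaleC_sbar2 :: "complex \<Rightarrow> sbar2 \<Rightarrow> sbar2"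
  is "\<lambda>c (p1, p2). (Polynomial.smult [:c:] p1, Polynomial.smult [:c:] p2)"
proof clarify
  fix a c p1 p2
  assume "pd1 p1 + pd2 p2 = [:[:c:]:]"
  moreover have "pd1 (Polynomial.smult [:a:] p1) + pd2 (Polynomial.smult [:a:] p2)
      = Polynomial.smult [:a:] (pd1 p1 + pd2 p2)"
    by (simp add: pd_simps smult_add_right)
  ultimately show "\<exists>c. pd1 (Polynomial.smult [:a:] p1) + pd2 (Polynomial.smult [:a:] p2) = [:[:c:]:]"
    by simp
qed
lift_definition lie_sbar2 :: "sbar2 \<Rightarrow> sbar2 \<Rightarrow> sbar2"
  is "\<lambda>(p1, p2) (q1, q2).
    (p1 * pd1 q1 + p2 * pd2 q1 - q1 * pd1 p1 - q2 * pd2 p1,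
     p1 * pd1 q2 + p2 * pd2 q2 - q1 * pd1 p2 - q2 * pd2 p2)"
proof clarify
  fix p1 p2 q1 q2 :: cpoly2 and c d
  assume p: "pd1 p1 + pd2 p2 = [:[:c:]:]" and q: "pd1 q1 + pd2 q2 = [:[:d:]:]"
  have "pd1 (p1 * pd1 q1 + p2 * pd2 q1 - q1 * pd1 p1 - q2 * pd2 p1)
      + pd2 (p1 * pd1 q2 + p2 * pd2 q2 - q1 * pd1 p2 - q2 * pd2 p2)
      = p1 * pd1 (pd1 q1 + pd2 q2) + p2 * pd2 (pd1 q1 + pd2 q2)
      - q1 * pd1 (pd1 p1 + pd2 p2) - q2 * pd2 (pd1 p1 + pd2 p2)"
    by (simp add: pd_simps algebra_simps)
  also have "\<dots> = [:[:0:]:]" by (simp only: p q pd_const) simp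
  finally show "\<exists>c. pd1 (p1 * pd1 q1 + p2 * pd2 q1 - q1 * pd1 p1 - q2 * pd2 p1)
      + pd2 (p1 * pd1 q2 + p2 * pd2 q2 - q1 * pd1 p2 - q2 * pd2 p2) = [:[:c:]:]" by blast
qed

instance
proof
  fix x y z :: sbar2 and a b :: complex
  show "x + y + z = x + (y + z)" by transfer (auto simp: add.assoc)
  show "x + y = y + x" by transfer (auto simp: add.commute)
  show "0 + x = x" by transfer auto
  show "- x + x = 0" by transfer auto
  show "x - y = x + - y" by (simp add: minus_sbar2_def)
  show "a *\<^sub>C (x + y) = a *\<^sub>C x + a *\<^sub>C y"
    by transfer (clarsimp simp: smult_add_right)
  show "(a + b) *\<^sub>C x = a *\<^sub>C x + b *\<^sub>C x"
    by transfer (clarsimp simp flip: smult_add_left)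
  show "a *\<^sub>C b *\<^sub>C x = (a * b) *\<^sub>C x"
    by transfer (clarsimp simp: mult.commute)
  show "1 *\<^sub>C x = x" by transfer (auto simp flip: one_pCons)
  show "lie (x + y) z = lie x z + lie y z"
    by transfer (auto simp: pd_simps algebra_simps)
  show "lie x (y + z) = lie x y + lie x z"
    by transfer (auto simp: pd_simps algebra_simps)
  show "lie (a *\<^sub>C x) y = a *\<^sub>C lie x y"
    by transfer (clarsimp simp: pd_simps smult_diff_right smult_add_right)
  show "lie x (a *\<^sub>C y) = a *\<^sub>C lie x y"
    by transfer (clarsimp simp: pd_simps smult_diff_right smult_add_right)
  show "lie x x = 0" by transfer auto
  show "lie x (lie y z) + lie y (lie z x) + lie z (lie x y) = 0"
    by transfer (auto simp: pd_simps algebra_simps)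
qed

end

lift_definition del1 :: sbar2 is "(1, 0)" by (auto intro!: exI[of _ 0])
lift_definition del2 :: sbar2 is "(0, 1)" by (auto intro!: exI[of _ 0])
lift_definition d1 :: sbar2 is "(t1, 0)"
  by (auto intro!: exI[of _ 1] simp flip: one_pCons)
lift_definition d2 :: sbar2 is "(0, t2)"
  by (auto intro!: exI[of _ 1] simp flip: one_pCons)



section \<open>The subalgebra spanned by the partial derivatives\<close>

typedef delta2 = "{x. \<exists>a b. x = a *\<^sub>C del1 + b *\<^sub>C del2}"
  morphisms delta2_incl Delta2
  by blast

setup_lifting type_definition_delta2

lemma lie_zero_left [simp]: "lie 0 (x::'a::complex_lie_algebra) = 0"
  using lie_add_left[of 0 0 x] by simp

lemma lie_del: "lie del1 del1 = 0" "lie del2 del2 = 0" "lie del1 del2 = 0" "lie del2 del1 = 0"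
  by (simp_all add: lie_self) (transfer; simp)+

instantiation delta2 :: complex_lie_algebra
begin

lift_definition zero_delta2 :: delta2 is 0
  by (rule exI[of _ 0], rule exI[of _ 0]) simp
lift_definition plus_delta2 :: "delta2 \<Rightarrow> delta2 \<Rightarrow> delta2" is "(+)"
proof clarify
  fix a b c d
  have "(a *\<^sub>C del1 + b *\<^sub>C del2) + (c *\<^sub>C del1 + d *\<^sub>C del2)
      = (a + c) *\<^sub>C del1 + (b + d) *\<^sub>C del2"
    by (simp add: scaleC_add_left algebra_simps)
  then show "\<exists>e f. (a *\<^sub>C del1 + b *\<^sub>C del2) + (c *\<^sub>C del1 + d *\<^sub>C del2)
      = e *\<^sub>C del1 + f *\<^sub>C del2" by blast
qed
lift_definition scaleC_delta2 :: "complex \<Rightarrow> delta2 \<Rightarrow> delta2" is "scaleC"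
proof clarify
  fix a b c
  have "a *\<^sub>C (b *\<^sub>C del1 + c *\<^sub>C del2) = (a * b) *\<^sub>C del1 + (a * c) *\<^sub>C del2"
    by (simp add: scaleC_add_right scaleC_scaleC)
  then show "\<exists>e f. a *\<^sub>C (b *\<^sub>C del1 + c *\<^sub>C del2) = e *\<^sub>C del1 + f *\<^sub>C del2" by blast
qed
definition uminus_delta2 :: "delta2 \<Rightarrow> delta2" where "uminus_delta2 x = (-1) *\<^sub>C x"
definition minus_delta2 :: "delta2 \<Rightarrow> delta2 \<Rightarrow> delta2" where "minus_delta2 x y = x + - y"
lift_definition lie_delta2 :: "delta2 \<Rightarrow> delta2 \<Rightarrow> delta2" is lie
proof clarify
  fix a b c d
  have "lie (a *\<^sub>C del1 + b *\<^sub>C del2) (c *\<^sub>C del1 + d *\<^sub>C del2) = 0 *\<^sub>C del1 + 0 *\<^sub>C del2"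
    by (simp add: lie_add_left lie_add_right lie_scaleC_left lie_scaleC_right lie_del)
  then show "\<exists>e f. lie (a *\<^sub>C del1 + b *\<^sub>C del2) (c *\<^sub>C del1 + d *\<^sub>C del2)
      = e *\<^sub>C del1 + f *\<^sub>C del2" by blast
qed

instance
proof
  fix x y z :: delta2 and a b :: complex
  show "x + y + z = x + (y + z)" by transfer (simp add: add.assoc)
  show "x + y = y + x" by transfer (simp add: add.commute)
  show "0 + x = x" by transfer simp
  show "- x + x = 0" unfolding uminus_delta2_def
    using scaleC_add_left[of "-1" 1 "delta2_incl x"] by transfer (simp add: scaleC_one)
  show "x - y = x + - y" by (simp add: minus_delta2_def)
  show "a *\<^sub>C (x + y) = a *\<^sub>C x + a *\<^sub>C y" by transfer (rule scaleC_add_right)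
  show "(a + b) *\<^sub>C x = a *\<^sub>C x + b *\<^sub>C x" by transfer (rule scaleC_add_left)
  show "a *\<^sub>C b *\<^sub>C x = (a * b) *\<^sub>C x" by transfer (rule scaleC_scaleC)
  show "1 *\<^sub>C x = x" by transfer (rule scaleC_one)
  show "lie (x + y) z = lie x z + lie y z" by transfer (rule lie_add_left)
  show "lie x (y + z) = lie x y + lie x z" by transfer (rule lie_add_right)
  show "lie (a *\<^sub>C x) y = a *\<^sub>C lie x y" by transfer (rule lie_scaleC_left)
  show "lie x (a *\<^sub>C y) = a *\<^sub>C lie x y" by transfer (rule lie_scaleC_right)
  show "lie x x = 0" by transfer (rule lie_self)
  show "lie x (lie y z) + lie y (lie z x) + lie z (lie x y) = 0" by transfer (rule lie_jacobi)
qed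

end

lift_definition delta2_del1 :: delta2 is del1
  by (rule exI[of _ 1], rule exI[of _ 0]) (simp add: scaleC_one)
lift_definition delta2_del2 :: delta2 is del2
  by (rule exI[of _ 0], rule exI[of _ 1]) (simp add: scaleC_one)

definition uea_incl :: "delta2 uea \<Rightarrow> sbar2 uea"
  where "uea_incl = uea_lift (\<lambda>x. uea_of (delta2_incl x))"

text \<open>The linear form \<open>a \<partial>\<^sub>1 + b \<partial>\<^sub>2 \<mapsto> a + b\<close>, read off from the (constant) components, and the
  character of \<open>U(\<Delta>\<^sub>2)\<close> through which it acts on the one-dimensional module \<open>\<complex>\<^sub>1\<close>, whose underlying
  space is \<open>\<complex>\<close> with \<open>v\<^sub>1 = 1\<close>.\<close>

definition char_one :: "delta2 \<Rightarrow> complex"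
  where "char_one x = (case components (delta2_incl x) of (p1, p2) \<Rightarrow>
    coeff (coeff p1 0) 0 + coeff (coeff p2 0) 0)"

definition uea_char_one :: "delta2 uea \<Rightarrow> complex"
  where "uea_char_one = uea_lift char_one"

lemma lie_to_assoc_hom_delta2_incl: "lie_to_assoc_hom (\<lambda>x. uea_of (delta2_incl x))"
  using lie_to_assoc_hom_uea_of[where 'a = sbar2]
  by (simp add: lie_to_assoc_hom_def plus_delta2.rep_eq scaleC_delta2.rep_eq lie_delta2.rep_eq)

lemma delta2_abelian: "lie x y = (0::delta2)"
  by transfer (auto simp: lie_add_left lie_add_right lie_scaleC_left lie_scaleC_right lie_del)

lemma char_one_del: "char_one delta2_del1 = 1" "char_one delta2_del2 = 1"
  by (simp_all add: char_one_def delta2_del1.rep_eq delta2_del2.rep_eq del1.rep_eq del2.rep_eq)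

lemma lie_to_assoc_hom_char_one: "lie_to_assoc_hom char_one"
  by (auto simp: lie_to_assoc_hom_def char_one_def delta2_abelian plus_delta2.rep_eq
      scaleC_delta2.rep_eq zero_delta2.rep_eq plus_sbar2.rep_eq scaleC_sbar2.rep_eq
      zero_sbar2.rep_eq scaleC_complex_def algebra_simps split: prod.splits)

lemma uea_incl_of: "uea_incl (uea_of x) = uea_of (delta2_incl x)"
  by (simp add: uea_incl_def uea_lift_of[OF lie_to_assoc_hom_delta2_incl])

lemma uea_char_one_del:
  "uea_char_one (uea_of delta2_del1) = 1" "uea_char_one (uea_of delta2_del2) = 1"
  by (simp_all add: uea_char_one_def uea_lift_of[OF lie_to_assoc_hom_char_one] char_one_del)


section \<open>The induced module\<close>

text \<open>Relations of the tensor product \<open>M \<otimes>\<^sub>R N\<close> over a noncommutative ring \<open>R\<close>, as a subgroup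
  of the free abelian group on \<open>M \<times> N\<close>; \<open>ra\<close> is the right action of \<open>R\<close> on \<open>M\<close> and \<open>la\<close> the
  left action on \<open>N\<close>.\<close>

inductive_set tensor_null ::
  "('m::ab_group_add \<Rightarrow> 'r \<Rightarrow> 'm) \<Rightarrow> ('r \<Rightarrow> 'n::ab_group_add \<Rightarrow> 'n) \<Rightarrow> ('m \<times> 'n \<Rightarrow>\<^sub>0 int) set"
  for ra la where
  add_left: "frag_of (m + m', n) - frag_of (m, n) - frag_of (m', n) \<in> tensor_null ra la"
| add_right: "frag_of (m, n + n') - frag_of (m, n) - frag_of (m, n') \<in> tensor_null ra la"
| balanced: "frag_of (ra m r, n) - frag_of (m, la r n) \<in> tensor_null ra la"
| zero: "0 \<in> tensor_null ra la"
| diff: "x \<in> tensor_null ra la \<Longrightarrow> y \<in> tensor_null ra la \<Longrightarrow> x - y \<in> tensor_null ra la"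

lemma tensor_null_uminus: "x \<in> tensor_null ra la \<Longrightarrow> - x \<in> tensor_null ra la"
  using tensor_null.diff[OF tensor_null.zero] by fastforce

lemma tensor_null_add:
  "x \<in> tensor_null ra la \<Longrightarrow> y \<in> tensor_null ra la \<Longrightarrow> x + y \<in> tensor_null ra la"
  using tensor_null.diff[OF _ tensor_null_uminus] by fastforce

abbreviation Q1_null :: "(sbar2 uea \<times> complex \<Rightarrow>\<^sub>0 int) set"
  where "Q1_null \<equiv> tensor_null (\<lambda>u r. u * uea_incl r) (\<lambda>r z. uea_char_one r * z)"

quotient_type Q1 = "sbar2 uea \<times> complex \<Rightarrow>\<^sub>0 int" / "\<lambda>x y. x - y \<in> Q1_null"
proof (rule equivpI)
  show "reflp (\<lambda>x y. x - y \<in> Q1_null)"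
    by (rule reflpI) (simp add: tensor_null.zero)
  show "symp (\<lambda>x y. x - y \<in> Q1_null)"
    by (rule sympI) (drule tensor_null_uminus, simp)
  show "transp (\<lambda>x y. x - y \<in> Q1_null)"
    by (rule transpI) (drule (1) tensor_null_add, simp)
qed

instantiation Q1 :: ab_group_add
begin

lift_definition zero_Q1 :: Q1 is 0 .
lift_definition plus_Q1 :: "Q1 \<Rightarrow> Q1 \<Rightarrow> Q1" is "(+)"
proof -
  fix p q r s :: "sbar2 uea \<times> complex \<Rightarrow>\<^sub>0 int"
  assume "p - q \<in> Q1_null" "r - s \<in> Q1_null"
  from tensor_null_add[OF this] show "p + r - (q + s) \<in> Q1_null" by (simp add: algebra_simps)
qed
lift_definition uminus_Q1 :: "Q1 \<Rightarrow> Q1" is uminus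
  by (drule tensor_null_uminus) (simp add: algebra_simps)
definition minus_Q1 :: "Q1 \<Rightarrow> Q1 \<Rightarrow> Q1" where "minus_Q1 x y = x + - y"

instance
proof
  fix x y z :: Q1
  show "x + y + z = x + (y + z)" by transfer (simp add: add.assoc tensor_null.zero)
  show "x + y = y + x" by transfer (simp add: add.commute tensor_null.zero)
  show "0 + x = x" by transfer (simp add: tensor_null.zero)
  show "- x + x = 0" by transfer (simp add: tensor_null.zero)
  show "x - y = x + - y" by (simp add: minus_Q1_def)
qed

end

lift_definition Q1_tensor :: "sbar2 uea \<Rightarrow> complex \<Rightarrow> Q1" is "\<lambda>(u::sbar2 uea) (z::complex). frag_of (u, z)" .

text \<open>The left action of \<open>U\<close>, with \<open>u (v \<otimes> z) = (u v) \<otimes> z\<close>.\<close>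

lift_definition Q1_act :: "sbar2 uea \<Rightarrow> Q1 \<Rightarrow> Q1"
  is "\<lambda>u::sbar2 uea. frag_extend (\<lambda>(v, z::complex). frag_of (u * v, z))"
proof -
  fix u :: "sbar2 uea" and p q :: "sbar2 uea \<times> complex \<Rightarrow>\<^sub>0 int"
  let ?e = "frag_extend (\<lambda>(v, z). frag_of (u * v, z :: complex))"
  have "?e x \<in> Q1_null" if "x \<in> Q1_null" for x
    using that
  proof induction
    case (add_left m m' n)
    show ?case
      using tensor_null.add_left[of "u * m" "u * m'" n] by (simp add: frag_extend_diff distrib_left)
  next
    case (add_right m n n')
    show ?case
      using tensor_null.add_right[of "u * m" n n'] by (simp add: frag_extend_diff)
  next
    case (balanced m r n)
    show ?case
      using tensor_null.balanced[of "\<lambda>u r. u * uea_incl r" "u * m" r n "\<lambda>r z. uea_char_one r * z"]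
      by (simp add: frag_extend_diff mult.assoc)
  qed (simp_all add: frag_extend_diff tensor_null.zero tensor_null.diff)
  moreover assume "p - q \<in> Q1_null"
  ultimately show "?e p - ?e q \<in> Q1_null" by (simp flip: frag_extend_diff)
qed

lemma Q1_act_tensor: "Q1_act u (Q1_tensor v z) = Q1_tensor (u * v) z"
  by transfer (simp add: tensor_null.zero)

lemma Q1_act_add_right: "Q1_act u (x + y) = Q1_act u x + Q1_act u y"
  by transfer (simp add: frag_extend_add tensor_null.zero)

lemma Q1_tensor_add_left: "Q1_tensor (u + v) z = Q1_tensor u z + Q1_tensor v z"
  by transfer (simp add: tensor_null.add_left flip: diff_diff_eq)

lemma Q1_induct [case_names tensor zero diff]:
  assumes "\<And>u z. P (Q1_tensor u z)" "P 0" "\<And>x y. P x \<Longrightarrow> P y \<Longrightarrow> P (x - y)"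
  shows "P x"
proof -
  have abs_diff: "abs_Q1 (p - q) = abs_Q1 p - abs_Q1 q" for p q
    by (simp add: minus_Q1_def uminus_Q1.abs_eq plus_Q1.abs_eq)
  have "P (abs_Q1 p)" for p
    using subset_UNIV
  proof (induction p rule: frag_induction)
    case zero
    show ?case using assms(2) by (simp add: zero_Q1_def)
  next
    case (one w)
    show ?case using assms(1)[of "fst w" "snd w"] by (simp add: Q1_tensor.abs_eq)
  next
    case (diff a b)
    then show ?case using assms(3) by (simp add: abs_diff)
  qed
  from this[of "rep_Q1 x"] show ?thesis by (simp add: Quotient3_abs_rep[OF Quotient3_Q1])
qed

lemma Q1_act_zero_right: "Q1_act u 0 = 0"
  using Q1_act_add_right[of u 0 0] by simp

lemma Q1_act_diff_right: "Q1_act u (x - y) = Q1_act u x - Q1_act u y"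
  using Q1_act_add_right[of u "x - y" y] by (simp add: algebra_simps)

lemma Q1_act_add_left: "Q1_act (u + v) x = Q1_act u x + Q1_act v x"
  by (induction x rule: Q1_induct)
    (simp_all add: Q1_act_tensor Q1_act_zero_right Q1_act_diff_right distrib_right
      Q1_tensor_add_left)

lemma Q1_act_mult: "Q1_act (u * v) x = Q1_act u (Q1_act v x)"
  by (induction x rule: Q1_induct)
    (simp_all add: Q1_act_tensor Q1_act_zero_right Q1_act_diff_right mult.assoc)

lemma Q1_act_one: "Q1_act 1 x = x"
  by (induction x rule: Q1_induct)
    (simp_all add: Q1_act_tensor Q1_act_zero_right Q1_act_diff_right)

instantiation Q1 :: complex_vector
begin
definition scaleC_Q1 :: "complex \<Rightarrow> Q1 \<Rightarrow> Q1" where "c *\<^sub>C x = Q1_act (c *\<^sub>C 1) x"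
instance
  by standard (simp_all add: scaleC_Q1_def Q1_act_add_right scaleC_add_left Q1_act_add_left
      scaleC_one Q1_act_one mult_scaleC_left scaleC_scaleC flip: Q1_act_mult)
end

text \<open>Right-to-left composition as product would give \<open>End\<close>; the product below is the opposite.\<close>

definition H1 :: "(complex, Q1 \<Rightarrow> Q1) module"
  where "H1 = \<lparr>
    carrier = {f. (\<forall>x y. f (x + y) = f x + f y) \<and> (\<forall>c x. f (c *\<^sub>C x) = c *\<^sub>C f x) \<and>
      (\<forall>X::sbar2. \<forall>x. f (Q1_act (uea_of X) x) = Q1_act (uea_of X) (f x))},
    monoid.mult = (\<lambda>f g. g \<circ> f),
    one = id,
    ring.zero = (\<lambda>_. 0),
    add = (\<lambda>f g x. f x + g x),
    module.smult = (\<lambda>c f x. c *\<^sub>C f x)\<rparr>"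


section \<open>Ore localization and the algebra \<open>H\<close>\<close>

text \<open>The left fraction \<open>s\<^sup>-\<^sup>1 r\<close> with \<open>s \<in> S\<close>, as an equivalence class of pairs. The operations on
  \<open>S\<^sup>-\<^sup>1 R\<close> are the usual ones, given as the union over all admissible choices; for a left Ore
  (denominator) set \<open>S\<close>, as \<open>del_powers\<close> below is, the union is over nonempty families of equal
  classes.\<close>

definition ore_frac :: "'a::ring_1 set \<Rightarrow> 'a \<Rightarrow> 'a \<Rightarrow> ('a \<times> 'a) set"
  where "ore_frac S s r =
    {(s', r'). s' \<in> S \<and> (\<exists>a b. a * s = b * s' \<and> a * s \<in> S \<and> a * r = b * r')}"

definition ore_localization ::
  "'a::complex_algebra_1 set \<Rightarrow> (complex, ('a \<times> 'a) set) module"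
  where "ore_localization S = \<lparr>
    carrier = {ore_frac S s r | s r. s \<in> S},
    monoid.mult = (\<lambda>x y. \<Union>{ore_frac S (b * s) (a * r') | s r s' r' a b.
      (s, r) \<in> x \<and> (s', r') \<in> y \<and> b \<in> S \<and> b * r = a * s'}),
    one = ore_frac S 1 1,
    ring.zero = ore_frac S 1 0,
    add = (\<lambda>x y. \<Union>{ore_frac S (a * s) (a * r + b * r') | s r s' r' a b.
      (s, r) \<in> x \<and> (s', r') \<in> y \<and> a * s = b * s' \<and> a * s \<in> S}),
    module.smult = (\<lambda>c x. \<Union>{ore_frac S s (c *\<^sub>C r) | s r. (s, r) \<in> x})\<rparr>"

definition del_powers :: "sbar2 uea set"
  where "del_powers = {uea_of del1 ^ i * uea_of del2 ^ j | i j. True}"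

definition U_loc :: "(complex, (sbar2 uea \<times> sbar2 uea) set) module"
  where "U_loc = ore_localization del_powers"

definition loc_of :: "sbar2 uea \<Rightarrow> (sbar2 uea \<times> sbar2 uea) set"
  where "loc_of u = ore_frac del_powers 1 u"

definition H :: "(complex, (sbar2 uea \<times> sbar2 uea) set) module"
  where "H = U_loc\<lparr>carrier := {u \<in> carrier U_loc. \<forall>X\<in>{del1, del2, d1, d2}.
    u \<otimes>\<^bsub>U_loc\<^esub> loc_of (uea_of X) \<ominus>\<^bsub>U_loc\<^esub> loc_of (uea_of X) \<otimes>\<^bsub>U_loc\<^esub> u = \<zero>\<^bsub>U_loc\<^esub>}\<rparr>"

end

theory Submission
  imports Defs
begin

text \<open>
  Let \<open>L\<close> be the localization. Every endomorphism of \<open>Q\<^sub>1\<close> turns out to be right multiplication by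
  an element of \<open>H\<close>, in the following sense. The generator \<open>1 \<otimes> 1\<close> of \<open>Q\<^sub>1\<close> is fixed by \<open>\<partial>\<^sub>1\<close> and
  \<open>\<partial>\<^sub>2\<close>, and these act bijectively, so \<open>s\<^sup>-\<^sup>1 r \<mapsto> s\<^sup>-\<^sup>1 (r \<otimes> 1)\<close> is a surjection from \<open>L\<close> onto \<open>Q\<^sub>1\<close>. Its
  kernel is the left ideal \<open>J = L (\<partial>\<^sub>1 - 1) + L (\<partial>\<^sub>2 - 1)\<close> (\<open>Q1_proj_eq_0_iff\<close>). An \<open>h\<close> that commutes
  with \<open>\<partial>\<^sub>1\<close> and \<open>\<partial>\<^sub>2\<close> satisfies \<open>J h \<subseteq> J\<close> and so acts on \<open>Q\<^sub>1 = L / J\<close> from the right, which gives the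
  homomorphism from \<open>H\<close> to \<open>End(Q\<^sub>1)\<^sup>o\<^sup>p\<close>.

  Bijectivity comes from the weights of \<open>ad d\<^sub>1\<close> and \<open>ad d\<^sub>2\<close>. The space \<open>L\<close> is spanned by weight
  vectors with integral weights, and \<open>\<partial>\<^sub>1, \<partial>\<^sub>2\<close> are units of weights \<open>(-1, 0)\<close> and \<open>(0, -1)\<close>. Modulo
  \<open>J\<close>, a vector \<open>x\<close> of weight \<open>(a, b)\<close> is congruent to \<open>x \<partial>\<^sub>1\<^sup>a \<partial>\<^sub>2\<^sup>b\<close>, which has weight zero. Summing over the
  weight components gives a projection onto the weight zero subalgebra \<open>L\<^sub>0\<close>, which does not distinguish \<open>x\<close>
  from \<open>x \<partial>\<^sub>i\<close> and hence kills \<open>J\<close>. So \<open>L = L\<^sub>0 \<oplus> J\<close>, and \<open>L\<^sub>0\<close> maps bijectively onto \<open>Q\<^sub>1\<close>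
  (\<open>Q1_proj_weight0_inj\<close>, \<open>Q1_proj_weight0_surj\<close>). An endomorphism is given by the image of the
  generator, a vector fixed by \<open>\<partial>\<^sub>1\<close> and \<open>\<partial>\<^sub>2\<close>. Conjugation by \<open>\<partial>\<^sub>i\<close> preserves \<open>L\<^sub>0\<close>, and on images in
  \<open>Q\<^sub>1\<close> it is the action of \<open>\<partial>\<^sub>i\<close>; so the fixed vectors correspond to the elements of \<open>L\<^sub>0\<close> that
  commute with \<open>\<partial>\<^sub>1\<close> and \<open>\<partial>\<^sub>2\<close>. These are the elements of \<open>H\<close>.

  To compute in \<open>L\<close>, the localization is realized as a ring type. Since \<open>ad (\<partial>\<^sub>1\<partial>\<^sub>2)\<close> is locally
  nilpotent on \<open>U\<close>, all Ore and reversibility conditions hold for the powers of \<open>\<partial>\<^sub>1\<partial>\<^sub>2\<close>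
  (\<open>ad_del12_locally_nilpotent\<close>). Right fractions form a left \<open>U\<close>-module on which \<open>\<partial>\<^sub>1\<partial>\<^sub>2\<close> acts
  bijectively; this module structure yields the product, and identifies the elements with the classes
  of left fractions (\<open>ore_frac_eq\<close>, \<open>U_loc_mult\<close>).
\<close>

section \<open>Ore conditions from locally nilpotent inner derivations\<close>

definition ad :: "'a::ring \<Rightarrow> 'a \<Rightarrow> 'a"
  where "ad a u = a * u - u * a"

lemma ad_funpow_zero [simp]: "(ad a ^^ n) 0 = 0"
  by (induction n) (simp_all add: ad_def)

lemma ad_funpow_add: "(ad a ^^ n) (u + v) = (ad a ^^ n) u + (ad a ^^ n) v"
  by (induction n arbitrary: u v) (simp_all add: ad_def algebra_simps)

lemma ad_funpow_mono: "(ad a ^^ n) u = 0 \<Longrightarrow> n \<le> m \<Longrightarrow> (ad a ^^ m) u = 0"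
  by (metis ad_funpow_zero comp_apply funpow_add le_add_diff_inverse2)

lemma ad_mult: "ad a (u * v) = ad a u * v + u * ad a v"
  by (simp add: ad_def algebra_simps)

text \<open>As \<open>ad a\<close> is a derivation, each application to \<open>u * v\<close> uses up one of the \<open>n + m\<close> steps that
  kill \<open>u\<close> and \<open>v\<close>; hence the elements killed by a power of \<open>ad a\<close> are closed under products.\<close>
lemma ad_nilpotent_mult:
  assumes "(ad a ^^ n) u = 0" "(ad a ^^ m) v = 0"
  shows "(ad a ^^ (n + m)) (u * v) = 0"
  using assms
proof (induction "n + m" arbitrary: n m u v)
  case 0
  then show ?case by simp
next
  case (Suc k)
  show ?case
  proof (cases "n = 0 \<or> m = 0")
    case True
    with Suc.prems show ?thesis by auto
  next
    case False
    then obtain i j where ij: "n = Suc i" "m = Suc j" by (meson not0_implies_Suc)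
    have "(ad a ^^ (i + m)) (ad a u * v) = 0"
      using Suc.prems Suc.hyps(2) by (intro Suc.hyps(1)) (simp_all add: ij funpow_swap1)
    moreover have "(ad a ^^ (n + j)) (u * ad a v) = 0"
      using Suc.prems Suc.hyps(2) by (intro Suc.hyps(1)) (simp_all add: ij funpow_swap1)
    moreover have "k = i + m" "k = n + j"
      using Suc.hyps(2) ij by simp_all
    ultimately have "(ad a ^^ k) (ad a (u * v)) = 0"
      by (simp add: ad_mult ad_funpow_add)
    then show ?thesis
      unfolding Suc.hyps(2)[symmetric] by (simp add: funpow_swap1)
  qed
qed

text \<open>For commuting \<open>a\<close> and \<open>b\<close> one has \<open>[a b, u] = a [b, u] + [a, u] b\<close>, and multiplication by \<open>a\<close>
  from the left and by \<open>b\<close> from the right commutes with \<open>ad (a b)\<close>. So every application of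
  \<open>ad (a b)\<close> costs one application of \<open>ad a\<close> or of \<open>ad b\<close>.\<close>
lemma ad_product_nilpotent:
  assumes "a * b = b * a" "(ad a ^^ n) u = 0" "(ad b ^^ m) u = 0"
  shows "(ad (a * b) ^^ (n + m)) u = 0"
  using assms(2,3)
proof (induction "n + m" arbitrary: n m u)
  case 0
  then show ?case by simp
next
  case (Suc k)
  have left: "(ad (a * b) ^^ j) (a * x) = a * (ad (a * b) ^^ j) x" for j x
  proof (induction j)
    case (Suc j)
    have "ad (a * b) (a * y) = a * ad (a * b) y" for y
    proof -
      have "a * b * (a * y) = a * (a * b * y)" by (metis assms(1) mult.assoc)
      then show ?thesis by (simp add: ad_def right_diff_distrib mult.assoc)
    qed
    with Suc show ?case by simp
  qed simp
  have right: "(ad (a * b) ^^ j) (x * b) = (ad (a * b) ^^ j) x * b" for j x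
  proof (induction j)
    case (Suc j)
    have "ad (a * b) (y * b) = ad (a * b) y * b" for y
    proof -
      have "y * b * (a * b) = y * (a * b) * b" by (metis assms(1) mult.assoc)
      then show ?thesis by (simp add: ad_def left_diff_distrib mult.assoc)
    qed
    with Suc show ?case by simp
  qed simp
  have comm: "(ad x ^^ j) (ad y u) = ad y ((ad x ^^ j) u)" if "x * y = y * x" for x y u :: 'a and j
  proof (induction j)
    case (Suc j)
    have "ad x (ad y v) = ad y (ad x v)" for v
    proof -
      have "x * (y * v) = y * (x * v)" "v * x * y = v * y * x"
        using that by (simp_all flip: mult.assoc) (simp add: that mult.assoc)
      then show ?thesis by (simp add: ad_def algebra_simps)
    qed
    with Suc show ?case by simp
  qed simp
  show ?case
  proof (cases "n = 0 \<or> m = 0")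
    case True
    with Suc.prems show ?thesis by auto
  next
    case False
    then obtain i j where ij: "n = Suc i" "m = Suc j" by (meson not0_implies_Suc)
    have k: "k = i + m" "k = n + j" using Suc.hyps(2) ij by simp_all
    have "(ad b ^^ m) (ad a u) = 0" "(ad a ^^ n) (ad b u) = 0"
      using Suc.prems assms(1) by (simp_all only: comm) (simp_all add: ad_def)
    moreover have "(ad a ^^ i) (ad a u) = 0" "(ad b ^^ j) (ad b u) = 0"
      using Suc.prems ij by (simp_all add: funpow_swap1)
    ultimately have 1: "(ad (a * b) ^^ (i + m)) (ad a u) = 0"
      and 2: "(ad (a * b) ^^ (n + j)) (ad b u) = 0"
      using Suc.hyps(1)[of i m "ad a u"] Suc.hyps(1)[of n j "ad b u"] k by simp_all
    have "ad (a * b) u = a * ad b u + ad a u * b"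
      by (simp add: ad_def algebra_simps)
    with 1 2 k have "(ad (a * b) ^^ k) (ad (a * b) u) = 0"
      by (simp add: ad_funpow_add left right)
    then show ?thesis
      unfolding Suc.hyps(2)[symmetric] by (simp add: funpow_swap1)
  qed
qed

text \<open>An element killed by a power of \<open>ad a\<close> satisfies the Ore conditions for the powers of \<open>a\<close>.
  The induction is on the nilpotency degree: if \<open>[a, u] a\<^sup>N = a v\<close>, then
  \<open>u a\<^sup>N\<^sup>+\<^sup>1 = a (u a\<^sup>N - v)\<close>, because \<open>u a = a u - [a, u]\<close>. The other three lemmas are variations.\<close>
lemma ore_right:
  fixes a u :: "'a::ring_1"
  assumes "(ad a ^^ n) u = 0"
  shows "\<exists>N v. u * a ^ N = a * v"
  using assms
proof (induction n arbitrary: u)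
  case 0
  then show ?case by (intro exI[of _ 0] exI[of _ 0]) simp
next
  case (Suc n)
  then obtain N v where "ad a u * a ^ N = a * v" by (force simp: funpow_swap1)
  then have "u * a ^ Suc N = a * (u * a ^ N - v)"
    by (simp add: ad_def algebra_simps)
  then show ?case by blast
qed

lemma ore_left:
  fixes a u :: "'a::ring_1"
  assumes "(ad a ^^ n) u = 0"
  shows "\<exists>N v. a ^ N * u = v * a"
  using assms
proof (induction n arbitrary: u)
  case 0
  then show ?case by (intro exI[of _ 0] exI[of _ 0]) simp
next
  case (Suc n)
  then obtain N v where "a ^ N * ad a u = v * a" by (force simp: funpow_swap1)
  then have "a ^ Suc N * u = (v + a ^ N * u) * a"
    unfolding power_Suc2 by (simp add: ad_def algebra_simps)
  then show ?case by blast
qed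

text \<open>If \<open>a u = 0\<close>, then \<open>[a, u] = - u a\<close> is again annihilated by \<open>a\<close> and has smaller
  nilpotency degree.\<close>
lemma reversible_right:
  fixes a u :: "'a::ring_1"
  assumes "(ad a ^^ n) u = 0" "a * u = 0"
  shows "\<exists>N. u * a ^ N = 0"
  using assms
proof (induction n arbitrary: u)
  case 0
  then show ?case by (intro exI[of _ 0]) simp
next
  case (Suc n)
  have "a * ad a u = 0"
    using Suc.prems(2) by (simp add: ad_def flip: mult.assoc)
  with Suc obtain N where "ad a u * a ^ N = 0" by (force simp: funpow_swap1)
  then have "u * a ^ Suc N = 0"
    using Suc.prems(2) by (simp add: ad_def mult.assoc)
  then show ?case by blast
qed

lemma reversible_left:
  fixes a u :: "'a::ring_1"
  assumes "(ad a ^^ n) u = 0" "u * a = 0"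
  shows "\<exists>N. a ^ N * u = 0"
  using assms
proof (induction n arbitrary: u)
  case 0
  then show ?case by (intro exI[of _ 0]) simp
next
  case (Suc n)
  have "ad a u * a = 0"
    using Suc.prems(2) by (simp add: ad_def mult.assoc)
  with Suc obtain N where "a ^ N * ad a u = 0" by (force simp: funpow_swap1)
  then have "a ^ Suc N * u = 0"
    unfolding power_Suc2 using Suc.prems(2) by (simp add: ad_def mult.assoc)
  then show ?case by blast
qed

section \<open>Partial derivatives are locally ad-nilpotent in the enveloping algebra\<close>

lemma abs_uea_add: "abs_uea (p + q) = abs_uea p + abs_uea q"
  by (simp add: plus_uea.abs_eq)
lemma abs_uea_mult: "abs_uea (p * q) = abs_uea p * abs_uea q"
  by (simp add: times_uea.abs_eq)
lemma abs_uea_const: "abs_uea (free_const c) = c *\<^sub>C 1"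
  by (simp add: one_uea_def scaleC_uea.abs_eq)

text \<open>\<open>U(g)\<close> is generated as an algebra by \<open>g\<close>.\<close>
lemma uea_induct [case_names const of add mult]:
  fixes P :: "'a::complex_lie_algebra uea \<Rightarrow> bool"
  assumes const: "\<And>c. P (c *\<^sub>C 1)" and of: "\<And>x. P (uea_of x)"
    and add: "\<And>u v. P u \<Longrightarrow> P v \<Longrightarrow> P (u + v)" and mult: "\<And>u v. P u \<Longrightarrow> P v \<Longrightarrow> P (u * v)"
  shows "P u"
proof -
  have word: "P (abs_uea (Poly_Mapping.single (Word xs) c))" for xs c
  proof (induction xs)
    case Nil
    have "Poly_Mapping.single (Word []) c = (free_const c :: 'a free_monoid \<Rightarrow>\<^sub>0 complex)"
      by (simp add: free_const_def zero_free_monoid_def)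
    then show ?case using const by (simp add: abs_uea_const)
  next
    case (Cons x xs)
    have "Poly_Mapping.single (Word (x # xs)) c = free_gen x * Poly_Mapping.single (Word xs) c"
      by (simp add: free_gen_def mult_single plus_free_monoid_def)
    then show ?case using of mult Cons by (simp add: abs_uea_mult flip: uea_of.abs_eq)
  qed
  have "P (abs_uea p)" for p
  proof (induction p rule: poly_mapping_single_add_induct)
    case zero
    show ?case using const[of 0] by (simp add: zero_uea_def)
  next
    case (single_add w c p)
    then show ?case using word[of "letters w" c] add by (simp add: abs_uea_add)
  qed
  from this[of "rep_uea u"] show ?thesis by (simp add: Quotient3_abs_rep[OF Quotient3_uea])
qed

lemma uea_of_add: "uea_of (x + y) = uea_of x + uea_of y"
  and uea_of_scaleC: "uea_of (c *\<^sub>C x) = c *\<^sub>C uea_of x"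
  and uea_of_lie: "uea_of (lie x y) = uea_of x * uea_of y - uea_of y * uea_of x"
  using lie_to_assoc_hom_uea_of[where 'a = 'a] by (simp_all add: lie_to_assoc_hom_def)

lemma uea_of_zero [simp]: "uea_of 0 = 0"
  using uea_of_add[of 0 0] by simp

abbreviation "Udel1 \<equiv> uea_of del1"
abbreviation "Udel2 \<equiv> uea_of del2"

lemma del_commute: "Udel1 * Udel2 = Udel2 * Udel1"
  using uea_of_lie[of del1 del2] by (simp add: lie_del)

text \<open>Localizing at the single element \<open>\<partial>\<^sub>1\<partial>\<^sub>2\<close> inverts all monomials in \<open>\<partial>\<^sub>1, \<partial>\<^sub>2\<close>, since each of
  them divides one of its powers.\<close>
definition del12 :: "sbar2 uea" where "del12 = Udel1 * Udel2"

lemma pd1_funpow_eq_0: "\<exists>n. (pd1 ^^ n) p = 0"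
proof -
  have c: "coeff ((pd1 ^^ n) p) i = (pderiv ^^ n) (coeff p i)" for n i
    by (induction n) (simp_all add: coeff_pd1)
  have z: "(pderiv ^^ n) q = 0" if "degree q < n" for n and q :: "complex poly"
    using that
  proof (induction n arbitrary: q)
    case (Suc n)
    show ?case
    proof (cases "degree q = 0")
      case True
      then have "pderiv q = 0" by (simp add: pderiv_eq_0_iff)
      moreover have "(pderiv ^^ n) 0 = (0::complex poly)" by (induction n) simp_all
      ultimately show ?thesis by (simp add: funpow_swap1)
    next
      case False
      with Suc show ?thesis by (simp add: funpow_swap1 degree_pderiv)
    qed
  qed simp
  define N where "N = Suc (\<Sum>i\<le>degree p. degree (coeff p i))"
  have "degree (coeff p i) < N" for i
  proof (cases "i \<le> degree p")
    case True
    then have "degree (coeff p i) \<le> (\<Sum>i\<le>degree p. degree (coeff p i))"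
      by (intro member_le_sum) auto
    then show ?thesis by (simp add: N_def)
  qed (simp add: coeff_eq_0 N_def)
  then have "(pd1 ^^ N) p = 0" by (intro poly_eqI) (simp add: c z)
  then show ?thesis ..
qed

lemma pd2_funpow_eq_0: "\<exists>n. (pd2 ^^ n) p = 0"
proof (induction "degree p" arbitrary: p)
  case 0
  then show ?case by (intro exI[of _ 1]) (simp add: pd2_def pderiv_eq_0_iff)
next
  case (Suc n)
  then have "n = degree (pd2 p)" by (simp add: pd2_def degree_pderiv)
  from Suc.hyps(1)[OF this] obtain k where "(pd2 ^^ k) (pd2 p) = 0" ..
  then show ?case by (intro exI[of _ "Suc k"]) (simp add: funpow_swap1)
qed

lemma components_lie_del:
  "components (lie del1 X) = (case components X of (p, q) \<Rightarrow> (pd1 p, pd1 q))"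
  "components (lie del2 X) = (case components X of (p, q) \<Rightarrow> (pd2 p, pd2 q))"
  by (transfer; clarsimp)+

lemma components_zero: "components X = (0, 0) \<longleftrightarrow> X = 0"
  using components_inject[of X 0] by (simp add: zero_sbar2.rep_eq)

lemma ad_uea_of_funpow: "(ad (uea_of x) ^^ n) (uea_of y) = uea_of ((lie x ^^ n) y)"
  by (induction n) (simp_all add: ad_def uea_of_lie)

lemma lie_del_nilpotent: "\<exists>n. (lie del1 ^^ n) X = 0" "\<exists>n. (lie del2 ^^ n) X = 0"
proof -
  obtain p q where X: "components X = (p, q)" by fastforce
  have z: "(f ^^ (n + m)) r = 0" if "(f ^^ n) r = 0" "f 0 = 0" for f :: "cpoly2 \<Rightarrow> cpoly2" and n m r
  proof -
    have "(f ^^ m) 0 = 0" using that(2) by (induction m) simp_all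
    then show ?thesis using that(1) by (simp add: funpow_add add.commute[of n])
  qed
  obtain n m where "(pd1 ^^ n) p = 0" "(pd1 ^^ m) q = 0" using pd1_funpow_eq_0 by metis
  then have "(pd1 ^^ (n + m)) p = 0" "(pd1 ^^ (n + m)) q = 0"
    using z[of n pd1 p m] z[of m pd1 q n] by (simp_all add: add.commute)
  moreover have "components ((lie del1 ^^ k) X) = ((pd1 ^^ k) p, (pd1 ^^ k) q)" for k
    by (induction k) (simp_all add: X components_lie_del)
  ultimately show "\<exists>n. (lie del1 ^^ n) X = 0" by (metis components_zero)
  obtain n m where "(pd2 ^^ n) p = 0" "(pd2 ^^ m) q = 0" using pd2_funpow_eq_0 by metis
  then have "(pd2 ^^ (n + m)) p = 0" "(pd2 ^^ (n + m)) q = 0"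
    using z[of n pd2 p m] z[of m pd2 q n] by (simp_all add: add.commute)
  moreover have "components ((lie del2 ^^ k) X) = ((pd2 ^^ k) p, (pd2 ^^ k) q)" for k
    by (induction k) (simp_all add: X components_lie_del)
  ultimately show "\<exists>n. (lie del2 ^^ n) X = 0" by (metis components_zero)
qed

text \<open>Bracketing a vector field with \<open>\<partial>\<^sub>i\<close> differentiates its coefficients, which are polynomials.
  This settles the generators, and the elements killed by a power of \<open>ad (\<partial>\<^sub>1\<partial>\<^sub>2)\<close> form a
  subalgebra.\<close>
lemma ad_del12_locally_nilpotent: "\<exists>n. (ad del12 ^^ n) u = 0"
proof (induction u rule: uea_induct)
  case (const c)
  show ?case by (intro exI[of _ 1]) (simp add: ad_def mult_scaleC_left mult_scaleC_right)
next
  case (of x)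
  obtain n m where "(lie del1 ^^ n) x = 0" "(lie del2 ^^ m) x = 0" using lie_del_nilpotent by metis
  then have "(ad del12 ^^ (n + m)) (uea_of x) = 0"
    unfolding del12_def by (intro ad_product_nilpotent del_commute) (simp_all add: ad_uea_of_funpow)
  then show ?case ..
next
  case (add u v)
  then obtain n m where "(ad del12 ^^ n) u = 0" "(ad del12 ^^ m) v = 0" by blast
  then have "(ad del12 ^^ (n + m)) u = 0" "(ad del12 ^^ (n + m)) v = 0"
    by (auto elim: ad_funpow_mono)
  then show ?case by (intro exI[of _ "n + m"]) (simp add: ad_funpow_add)
next
  case (mult u v)
  then show ?case using ad_nilpotent_mult by blast
qed

lemma del12_ore_right: "\<exists>N v. u * del12 ^ N = del12 ^ n * v"
proof (induction n)
  case 0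
  show ?case by (intro exI[of _ 0] exI[of _ u]) simp
next
  case (Suc n)
  then obtain N v where "u * del12 ^ N = del12 ^ n * v" by blast
  moreover obtain M w where "v * del12 ^ M = del12 * w"
    using ad_del12_locally_nilpotent ore_right by metis
  ultimately have "u * del12 ^ (N + M) = del12 ^ Suc n * w"
    unfolding power_Suc2 power_add by (metis mult.assoc)
  then show ?case by blast
qed

lemma del12_ore_left: "\<exists>N v. del12 ^ N * u = v * del12 ^ n"
proof (induction n)
  case 0
  show ?case by (intro exI[of _ 0] exI[of _ u]) simp
next
  case (Suc n)
  then obtain N v where "del12 ^ N * u = v * del12 ^ n" by blast
  moreover obtain M w where "del12 ^ M * v = w * del12"
    using ad_del12_locally_nilpotent ore_left by metis
  ultimately have "del12 ^ (M + N) * u = w * del12 ^ Suc n"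
    unfolding power_Suc power_add by (metis mult.assoc)
  then show ?case by blast
qed

lemma del12_reversible_right: "del12 ^ n * u = 0 \<Longrightarrow> \<exists>N. u * del12 ^ N = 0"
proof (induction n arbitrary: u)
  case 0
  then show ?case by simp
next
  case (Suc n)
  have "del12 ^ n * (del12 * u) = 0"
    using Suc.prems by (simp add: power_commutes flip: mult.assoc)
  then obtain N where "del12 * u * del12 ^ N = 0" using Suc.IH by blast
  then have "del12 * (u * del12 ^ N) = 0" by (simp add: mult.assoc)
  then obtain M where "u * del12 ^ N * del12 ^ M = 0"
    using ad_del12_locally_nilpotent reversible_right by metis
  then have "u * del12 ^ (N + M) = 0" by (simp add: power_add mult.assoc)
  then show ?case ..
qed

lemma del12_reversible_left: "u * del12 ^ n = 0 \<Longrightarrow> \<exists>N. del12 ^ N * u = 0"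
proof (induction n arbitrary: u)
  case 0
  then show ?case by simp
next
  case (Suc n)
  have "u * del12 * del12 ^ n = 0"
    using Suc.prems by (simp add: mult.assoc)
  then obtain N where "del12 ^ N * (u * del12) = 0" using Suc.IH by blast
  then have "del12 ^ N * u * del12 = 0" by (simp add: mult.assoc)
  then obtain M where "del12 ^ M * (del12 ^ N * u) = 0"
    using ad_del12_locally_nilpotent reversible_left by metis
  then have "del12 ^ (M + N) * u = 0" by (simp add: power_add mult.assoc)
  then show ?case ..
qed

section \<open>The ring of fractions\<close>

text \<open>The pair \<open>(r, n)\<close> stands for the right fraction \<open>r (\<partial>\<^sub>1\<partial>\<^sub>2)\<^sup>-\<^sup>n\<close>. Although the localization is
  defined by left fractions, right fractions are the better model to start from: \<open>U\<close> acts on them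
  from the left by acting on numerators. Left fractions and the product are then recovered from the
  fact that \<open>\<partial>\<^sub>1\<partial>\<^sub>2\<close> acts bijectively.\<close>
definition uloc_rel :: "sbar2 uea \<times> nat \<Rightarrow> sbar2 uea \<times> nat \<Rightarrow> bool"
  where "uloc_rel = (\<lambda>(r, n) (s, m). \<exists>k. r * del12 ^ (m + k) = s * del12 ^ (n + k))"

lemma uloc_rel_iff: "uloc_rel (r, n) (s, m) \<longleftrightarrow> (\<exists>k. r * del12 ^ (m + k) = s * del12 ^ (n + k))"
  by (simp add: uloc_rel_def)

quotient_type uloc = "sbar2 uea \<times> nat" / uloc_rel
proof (rule equivpI)
  show "reflp uloc_rel"
    by (rule reflpI) (auto simp: uloc_rel_def)
  show "symp uloc_rel"
    by (rule sympI) (auto simp: uloc_rel_def intro: sym)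
  show "transp uloc_rel"
  proof (rule transpI)
    fix x y z :: "sbar2 uea \<times> nat"
    obtain r a s b u c where [simp]: "x = (r, a)" "y = (s, b)" "z = (u, c)"
      by (metis surj_pair)
    assume "uloc_rel x y" "uloc_rel y z"
    then obtain k j where k: "r * del12 ^ (b + k) = s * del12 ^ (a + k)"
      and j: "s * del12 ^ (c + j) = u * del12 ^ (b + j)"
      by (auto simp: uloc_rel_iff)
    have "r * del12 ^ (c + (b + k + j)) = r * del12 ^ (b + k) * del12 ^ (c + j)"
      by (simp add: ac_simps flip: power_add mult.assoc) (simp add: mult.assoc ac_simps flip: power_add)
    also have "\<dots> = s * del12 ^ (c + j) * del12 ^ (a + k)"
      by (simp add: k mult.assoc add.commute flip: power_add)
    also have "\<dots> = u * del12 ^ (a + (b + k + j))"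
      by (simp add: j mult.assoc ac_simps flip: power_add)
    finally show "uloc_rel x z"
      by (auto simp: uloc_rel_iff)
  qed
qed

lift_definition rfrac :: "sbar2 uea \<Rightarrow> nat \<Rightarrow> uloc" is "\<lambda>(r::sbar2 uea) (n::nat). (r, n)" .

lemma rfrac_eq_iff: "rfrac r n = rfrac s m \<longleftrightarrow> (\<exists>k. r * del12 ^ (m + k) = s * del12 ^ (n + k))"
  by transfer (simp add: uloc_rel_iff)

lemma rfrac_cancel: "rfrac (r * del12 ^ k) (n + k) = rfrac r n"
  unfolding rfrac_eq_iff by (intro exI[of _ 0]) (simp add: mult.assoc add.commute flip: power_add)

lemma rfrac_cases: obtains r n where "x = rfrac r n"
proof -
  have "rfrac (fst (rep_uloc x)) (snd (rep_uloc x)) = x"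
    by (simp add: rfrac.abs_eq Quotient3_abs_rep[OF Quotient3_uloc])
  then show ?thesis using that by metis
qed

lemma rfrac_common3:
  obtains r s u n where "x = rfrac r n" "y = rfrac s n" "z = rfrac u n"
proof -
  obtain r a s b u c where x: "x = rfrac r a" and y: "y = rfrac s b" and z: "z = rfrac u c"
    by (metis rfrac_cases)
  show ?thesis
  proof (rule that)
    show "x = rfrac (r * del12 ^ (b + c)) (a + b + c)" by (simp only: x add.assoc rfrac_cancel)
    show "y = rfrac (s * del12 ^ (a + c)) (a + b + c)"
      using rfrac_cancel[of s "a + c" b] by (simp add: y ac_simps)
    show "z = rfrac (u * del12 ^ (a + b)) (a + b + c)"
      using rfrac_cancel[of u "a + b" c] by (simp add: z ac_simps)
  qed
qed

lemma rfrac_common: obtains r s n where "x = rfrac r n" "y = rfrac s n"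
  by (metis rfrac_common3)

lemma uloc_rel_I: "r * del12 ^ (m + k) = s * del12 ^ (n + k) \<Longrightarrow> uloc_rel (r, n) (s, m)"
  by (auto simp: uloc_rel_iff)

lift_definition left_act :: "sbar2 uea \<Rightarrow> uloc \<Rightarrow> uloc" is "\<lambda>(u::sbar2 uea) (r::sbar2 uea, n::nat). (u * r, n)"
  by (auto simp: uloc_rel_iff mult.assoc) metis

lemma left_act_rfrac: "left_act u (rfrac r n) = rfrac (u * r) n"
  by (simp add: rfrac.abs_eq left_act.abs_eq)

instantiation uloc :: complex_vector
begin

lift_definition zero_uloc :: uloc is "(0::sbar2 uea, 0::nat)" .
lift_definition plus_uloc :: "uloc \<Rightarrow> uloc \<Rightarrow> uloc"
  is "\<lambda>(r::sbar2 uea, n::nat) (s::sbar2 uea, m). (r * del12 ^ m + s * del12 ^ n, n + m)"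
proof clarsimp
  fix r r' s s' :: "sbar2 uea" and a a' b b' :: nat
  assume "uloc_rel (r, a) (r', a')" "uloc_rel (s, b) (s', b')"
  then obtain k j where k: "r * del12 ^ (a' + k) = r' * del12 ^ (a + k)"
    and j: "s * del12 ^ (b' + j) = s' * del12 ^ (b + j)"
    by (auto simp: uloc_rel_iff)
  have "r * del12 ^ b * del12 ^ (a' + b' + (k + j)) = r * del12 ^ (a' + k) * del12 ^ (b + b' + j)"
    "r' * del12 ^ b' * del12 ^ (a + b + (k + j)) = r' * del12 ^ (a + k) * del12 ^ (b + b' + j)"
    "s * del12 ^ a * del12 ^ (a' + b' + (k + j)) = s * del12 ^ (b' + j) * del12 ^ (a + a' + k)"
    "s' * del12 ^ a' * del12 ^ (a + b + (k + j)) = s' * del12 ^ (b + j) * del12 ^ (a + a' + k)"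
    by (simp_all add: mult.assoc ac_simps flip: power_add)
  then show "uloc_rel (r * del12 ^ b + s * del12 ^ a, a + b) (r' * del12 ^ b' + s' * del12 ^ a', a' + b')"
    by (intro uloc_rel_I[where k = "k + j"]) (simp add: distrib_right k j)
qed
lift_definition uminus_uloc :: "uloc \<Rightarrow> uloc" is "\<lambda>(r::sbar2 uea, n::nat). (- r, n)"
  by (auto simp: uloc_rel_iff)
definition minus_uloc :: "uloc \<Rightarrow> uloc \<Rightarrow> uloc" where "minus_uloc x y = x + - y"
definition scaleC_uloc :: "complex \<Rightarrow> uloc \<Rightarrow> uloc" where "scaleC_uloc c x = left_act (c *\<^sub>C 1) x"

lemma rfrac_zero: "rfrac 0 n = 0"
proof -
  have "rfrac 0 n = rfrac 0 0" by (simp add: rfrac_eq_iff)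
  then show ?thesis by (simp add: zero_uloc.abs_eq rfrac.abs_eq)
qed

lemma rfrac_add: "rfrac r n + rfrac s n = rfrac (r + s) n"
  using rfrac_cancel[of "r + s" n n]
  by (simp add: rfrac.abs_eq plus_uloc.abs_eq distrib_right)

lemma rfrac_uminus: "- rfrac r n = rfrac (- r) n"
  by (simp add: rfrac.abs_eq uminus_uloc.abs_eq)

instance
proof
  fix x y z :: uloc and c d :: complex
  obtain r s u n where [simp]: "x = rfrac r n" "y = rfrac s n" "z = rfrac u n"
    by (rule rfrac_common3)
  show "x + y + z = x + (y + z)" "x + y = y + x" "- x + x = 0" "0 + x = x"
    using rfrac_add[of 0 n r]
    by (simp_all add: rfrac_add rfrac_uminus rfrac_zero ac_simps)
  show "x - y = x + - y" by (simp add: minus_uloc_def)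
  show "c *\<^sub>C (x + y) = c *\<^sub>C x + c *\<^sub>C y" "(c + d) *\<^sub>C x = c *\<^sub>C x + d *\<^sub>C x"
    "c *\<^sub>C d *\<^sub>C x = (c * d) *\<^sub>C x" "1 *\<^sub>C x = x"
    by (simp_all add: scaleC_uloc_def left_act_rfrac rfrac_add distrib_left scaleC_add_left
        distrib_right scaleC_one scaleC_scaleC mult_scaleC_left)
qed

end

lemma left_act_add_right: "left_act u (x + y) = left_act u x + left_act u y"
  by (rule rfrac_common[of x y]) (simp add: rfrac_add left_act_rfrac distrib_left)

lemma left_act_add_left: "left_act (u + v) x = left_act u x + left_act v x"
  by (rule rfrac_cases[of x]) (simp add: rfrac_add left_act_rfrac distrib_right)

lemma left_act_mult: "left_act (u * v) x = left_act u (left_act v x)"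
  by (rule rfrac_cases[of x]) (simp add: left_act_rfrac mult.assoc)

lemma left_act_one [simp]: "left_act 1 x = x"
  by (rule rfrac_cases[of x]) (simp add: left_act_rfrac)

text \<open>Right reversibility of \<open>\<partial>\<^sub>1\<partial>\<^sub>2\<close> says precisely that its left action on right
  fractions is injective; surjectivity below is the right Ore condition.\<close>
lemma left_act_del12_inj:
  assumes "left_act (del12 ^ n) x = left_act (del12 ^ n) y"
  shows "x = y"
proof -
  obtain r s m where xy: "x = rfrac r m" "y = rfrac s m" by (rule rfrac_common)
  with assms obtain k where "del12 ^ n * r * del12 ^ k = del12 ^ n * s * del12 ^ k"
    by (auto simp: left_act_rfrac rfrac_eq_iff)
  then have "del12 ^ n * ((r - s) * del12 ^ k) = 0" by (simp add: algebra_simps)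
  then obtain N where "(r - s) * del12 ^ k * del12 ^ N = 0" using del12_reversible_right by blast
  then have "(r - s) * del12 ^ (k + N) = 0" by (simp add: power_add mult.assoc)
  then have "r * del12 ^ (k + N) * del12 ^ m = s * del12 ^ (k + N) * del12 ^ m" by (simp add: left_diff_distrib)
  then have "r * del12 ^ (m + (k + N)) = s * del12 ^ (m + (k + N))"
    by (simp add: mult.assoc ac_simps flip: power_add)
  then show ?thesis unfolding xy rfrac_eq_iff by blast
qed

text \<open>Every right fraction is also a left fraction \<open>(\<partial>\<^sub>1\<partial>\<^sub>2)\<^sup>-\<^sup>n r\<close>.\<close>
lemma left_act_del12_uloc_of: "\<exists>n r. left_act (del12 ^ n) x = rfrac r 0"
proof -
  obtain s m where x: "x = rfrac s m" by (rule rfrac_cases)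
  obtain N v where "del12 ^ N * s = v * del12 ^ m" using del12_ore_left by blast
  then have "left_act (del12 ^ N) x = rfrac v 0"
    using rfrac_cancel[of v m 0] by (simp add: x left_act_rfrac)
  then show ?thesis by blast
qed

lemma rfrac_0_eq_iff: "rfrac r 0 = rfrac s 0 \<longleftrightarrow> (\<exists>N. del12 ^ N * r = del12 ^ N * s)"
proof
  assume "rfrac r 0 = rfrac s 0"
  then obtain k where "(r - s) * del12 ^ k = 0" by (auto simp: rfrac_eq_iff algebra_simps)
  then obtain N where "del12 ^ N * (r - s) = 0" using del12_reversible_left by blast
  then show "\<exists>N. del12 ^ N * r = del12 ^ N * s" by (auto simp: algebra_simps)
next
  assume "\<exists>N. del12 ^ N * r = del12 ^ N * s"
  then obtain N where "del12 ^ N * r = del12 ^ N * s" ..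
  then have "left_act (del12 ^ N) (rfrac r 0) = left_act (del12 ^ N) (rfrac s 0)" by (simp add: left_act_rfrac)
  then show "rfrac r 0 = rfrac s 0" by (rule left_act_del12_inj)
qed

lemma left_act_del12_surj: "\<exists>y. left_act (del12 ^ n) y = x"
proof -
  obtain r m where x: "x = rfrac r m" by (rule rfrac_cases)
  obtain N v where "r * del12 ^ N = del12 ^ n * v" using del12_ore_right by blast
  then have "left_act (del12 ^ n) (rfrac v (m + N)) = x"
    using rfrac_cancel[of r N m] by (simp add: x left_act_rfrac)
  then show ?thesis ..
qed

text \<open>To multiply \<open>x\<close> by \<open>y\<close>, write \<open>x\<close> as a left fraction \<open>(\<partial>\<^sub>1\<partial>\<^sub>2)\<^sup>-\<^sup>n r\<close> and let \<open>r\<close> and then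
  \<open>(\<partial>\<^sub>1\<partial>\<^sub>2)\<^sup>-\<^sup>n\<close> act on \<open>y\<close>. With this description the ring axioms reduce to the module axioms.
  The class \<open>ring_1\<close> would include \<open>0 \<noteq> 1\<close>, that is, the assertion that no power of \<open>\<partial>\<^sub>1\<partial>\<^sub>2\<close>
  vanishes in \<open>U\<close>.\<close>
instantiation uloc :: "{ring, monoid_mult}"
begin

definition one_uloc :: uloc where "one_uloc = rfrac 1 0"

definition times_uloc :: "uloc \<Rightarrow> uloc \<Rightarrow> uloc" where
  "times_uloc x y = (THE w. \<exists>n r. left_act (del12 ^ n) x = rfrac r 0 \<and> left_act (del12 ^ n) w = left_act r y)"

lemma left_act_times:
  assumes "left_act (del12 ^ n) x = rfrac r 0"
  shows "left_act (del12 ^ n) (x * y) = left_act r y"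
proof -
  obtain w where w: "left_act (del12 ^ n) w = left_act r y" using left_act_del12_surj by blast
  have "x * y = w"
    unfolding times_uloc_def
  proof (rule the_equality)
    show "\<exists>n r. left_act (del12 ^ n) x = rfrac r 0 \<and> left_act (del12 ^ n) w = left_act r y"
      using assms w by blast
  next
    fix w' assume "\<exists>n r. left_act (del12 ^ n) x = rfrac r 0 \<and> left_act (del12 ^ n) w' = left_act r y"
    then obtain m s where s: "left_act (del12 ^ m) x = rfrac s 0" "left_act (del12 ^ m) w' = left_act s y" by blast
    \<comment> \<open>Bring the two left fractions representing \<open>x\<close> to a common denominator.\<close>
    have c: "del12 ^ m * del12 ^ n = del12 ^ n * del12 ^ m" by (metis power_add add.commute)
    have "rfrac (del12 ^ m * r) 0 = left_act (del12 ^ m) (left_act (del12 ^ n) x)"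
      by (simp add: assms left_act_rfrac)
    also have "\<dots> = left_act (del12 ^ n) (left_act (del12 ^ m) x)"
      by (simp add: c flip: left_act_mult)
    also have "\<dots> = rfrac (del12 ^ n * s) 0" by (simp add: s left_act_rfrac)
    finally obtain N where N: "del12 ^ N * (del12 ^ m * r) = del12 ^ N * (del12 ^ n * s)"
      by (auto simp: rfrac_0_eq_iff)
    have "left_act (del12 ^ N * (del12 ^ m * del12 ^ n)) w' = left_act (del12 ^ N * (del12 ^ n * s)) y"
      by (simp add: s(2) c left_act_mult)
    also have "\<dots> = left_act (del12 ^ N * (del12 ^ m * del12 ^ n)) w"
      by (simp add: w left_act_mult flip: N)
    finally show "w' = w"
      by (simp add: left_act_del12_inj flip: power_add)
  qed
  with w show ?thesis by simp
qed

text \<open>If \<open>x = (\<partial>\<^sub>1\<partial>\<^sub>2)\<^sup>-\<^sup>n r\<close> and \<open>(\<partial>\<^sub>1\<partial>\<^sub>2)\<^sup>N u = v (\<partial>\<^sub>1\<partial>\<^sub>2)\<^sup>n\<close>, then \<open>u x\<close> is the left fraction with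
  denominator \<open>(\<partial>\<^sub>1\<partial>\<^sub>2)\<^sup>N\<close> and numerator \<open>v r\<close>.\<close>
lemma left_act_mult_assoc: "left_act u x * y = left_act u (x * y)"
proof -
  obtain n r where r: "left_act (del12 ^ n) x = rfrac r 0" using left_act_del12_uloc_of by blast
  obtain N v where v: "del12 ^ N * u = v * del12 ^ n" using del12_ore_left by blast
  have "left_act (del12 ^ N) (left_act u x) = rfrac (v * r) 0"
    by (simp add: v r left_act_mult left_act_rfrac flip: left_act_mult[of "del12 ^ N"])
  from left_act_times[OF this, of y]
  have "left_act (del12 ^ N) (left_act u x * y) = left_act v (left_act r y)" by (simp add: left_act_mult)
  also have "\<dots> = left_act (del12 ^ N) (left_act u (x * y))"
    by (simp add: v left_act_times[OF r] left_act_mult flip: left_act_mult[of "del12 ^ N"])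
  finally show ?thesis by (rule left_act_del12_inj)
qed

lemma rfrac_times: "rfrac u 0 * y = left_act u y"
  using left_act_times[of 0 "rfrac u 0" u y] by simp

instance
proof
  fix x y z :: uloc
  obtain n r where r: "left_act (del12 ^ n) x = rfrac r 0" using left_act_del12_uloc_of by blast
  obtain m s where s: "left_act (del12 ^ m) y = rfrac s 0" using left_act_del12_uloc_of by blast
  have "left_act (del12 ^ n) (x * y * z) = left_act r y * z"
    by (simp only: left_act_times[OF r, symmetric] left_act_mult_assoc)
  also have "\<dots> = left_act (del12 ^ n) (x * (y * z))"
    by (simp only: left_act_times[OF r] left_act_mult_assoc)
  finally show "x * y * z = x * (y * z)" by (rule left_act_del12_inj)
  have "left_act (del12 ^ n) (x * (y + z)) = left_act (del12 ^ n) (x * y + x * z)"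
    by (simp add: left_act_times[OF r] left_act_add_right)
  then show "x * (y + z) = x * y + x * z" by (rule left_act_del12_inj)
  have c: "del12 ^ (n + m) = del12 ^ m * del12 ^ n" "del12 ^ (n + m) = del12 ^ n * del12 ^ m"
    by (simp_all add: add.commute flip: power_add)
  have xy: "left_act (del12 ^ (n + m)) (x + y) = rfrac (del12 ^ m * r + del12 ^ n * s) 0"
    unfolding left_act_add_right
    by (subst c(1), subst c(2)) (simp add: r s left_act_mult left_act_rfrac rfrac_add)
  have "left_act (del12 ^ (n + m)) (x * z + y * z) = left_act (del12 ^ m * r) z + left_act (del12 ^ n * s) z"
    unfolding left_act_add_right
    by (subst c(1), subst c(2)) (simp add: left_act_times[OF r] left_act_times[OF s] left_act_mult)
  then have "left_act (del12 ^ (n + m)) ((x + y) * z) = left_act (del12 ^ (n + m)) (x * z + y * z)"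
    by (simp add: left_act_times[OF xy] left_act_add_left)
  then show "(x + y) * z = x * z + y * z" by (rule left_act_del12_inj)
  show "1 * x = x" by (simp add: one_uloc_def rfrac_times)
  have "left_act (del12 ^ n) (x * 1) = left_act (del12 ^ n) x"
    by (simp add: left_act_times[OF r] r one_uloc_def left_act_rfrac)
  then show "x * 1 = x" by (rule left_act_del12_inj)
qed

end

lemma uloc_scaleC_mult_left: "(c *\<^sub>C x) * y = c *\<^sub>C (x * (y::uloc))"
  by (simp add: scaleC_uloc_def left_act_mult_assoc)

lemma uloc_scaleC_mult_right: "x * (c *\<^sub>C y) = c *\<^sub>C (x * (y::uloc))"
proof -
  obtain n r where r: "left_act (del12 ^ n) x = rfrac r 0" using left_act_del12_uloc_of by blast
  have "left_act (del12 ^ n) (x * (c *\<^sub>C y)) = left_act (del12 ^ n) (c *\<^sub>C (x * y))"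
    using left_act_times[OF r]
    by (simp add: scaleC_uloc_def mult_scaleC_right mult_scaleC_left flip: left_act_mult)
       (metis left_act_mult mult_scaleC_left mult_1)
  then show ?thesis by (rule left_act_del12_inj)
qed

definition uloc_of :: "sbar2 uea \<Rightarrow> uloc" where "uloc_of u = rfrac u 0"

lemma uloc_of_add: "uloc_of (u + v) = uloc_of u + uloc_of v"
  by (simp add: uloc_of_def rfrac_add)
lemma uloc_of_mult: "uloc_of (u * v) = uloc_of u * uloc_of v"
  by (simp add: uloc_of_def rfrac_times left_act_rfrac)
lemma uloc_of_one [simp]: "uloc_of 1 = 1"
  by (simp add: uloc_of_def one_uloc_def)
lemma uloc_of_zero [simp]: "uloc_of 0 = 0"
  by (simp add: uloc_of_def rfrac_zero)
lemma uloc_of_scaleC: "uloc_of (c *\<^sub>C u) = c *\<^sub>C uloc_of u"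
  by (simp add: uloc_of_def scaleC_uloc_def left_act_rfrac mult_scaleC_left)
lemma uloc_of_diff: "uloc_of (u - v) = uloc_of u - uloc_of v"
  using uloc_of_add[of "u - v" v] by (simp add: algebra_simps)
lemma uloc_of_power: "uloc_of (u ^ n) = uloc_of u ^ n"
  by (induction n) (simp_all add: uloc_of_mult)
lemma left_act_conv_mult: "left_act u x = uloc_of u * x"
  by (simp add: uloc_of_def rfrac_times)

definition del12_inv :: uloc where "del12_inv = rfrac 1 1"

lemma del12_inv: "uloc_of del12 * del12_inv = 1" "del12_inv * uloc_of del12 = 1"
proof -
  have "left_act (del12 ^ 1) del12_inv = 1"
    using rfrac_cancel[of 1 1 0] by (simp add: del12_inv_def left_act_rfrac one_uloc_def)
  then show 1: "uloc_of del12 * del12_inv = 1" by (simp add: left_act_conv_mult)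
  have "left_act (del12 ^ 1) (del12_inv * uloc_of del12) = left_act (del12 ^ 1) 1"
    by (simp add: left_act_conv_mult 1 flip: mult.assoc)
  then show "del12_inv * uloc_of del12 = 1" by (rule left_act_del12_inj)
qed

lemma rfrac_conv_mult: "rfrac r n = uloc_of r * del12_inv ^ n"
proof -
  have "rfrac 1 n = del12_inv ^ n"
  proof (induction n)
    case 0
    show ?case by (simp add: one_uloc_def)
  next
    case (Suc n)
    have "left_act (del12 ^ 1) (rfrac 1 (Suc n)) = rfrac 1 n"
      using rfrac_cancel[of 1 1 n] by (simp add: left_act_rfrac)
    also have "\<dots> = left_act (del12 ^ 1) (del12_inv ^ Suc n)"
      by (simp add: Suc left_act_conv_mult del12_inv flip: mult.assoc)
    finally show ?case by (rule left_act_del12_inj)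
  qed
  then show ?thesis using left_act_rfrac[of r 1 n] by (simp add: left_act_conv_mult)
qed

abbreviation "Ldel1 \<equiv> uloc_of Udel1"
abbreviation "Ldel2 \<equiv> uloc_of Udel2"
text \<open>As \<open>\<partial>\<^sub>1\<close> and \<open>\<partial>\<^sub>2\<close> commute, their inverses are \<open>\<partial>\<^sub>2 (\<partial>\<^sub>1\<partial>\<^sub>2)\<^sup>-\<^sup>1\<close> and \<open>\<partial>\<^sub>1 (\<partial>\<^sub>1\<partial>\<^sub>2)\<^sup>-\<^sup>1\<close>.\<close>
definition "Ldel1_inv = Ldel2 * del12_inv"
definition "Ldel2_inv = Ldel1 * del12_inv"

lemma Ldel_commute: "Ldel1 * Ldel2 = Ldel2 * Ldel1"
  using del_commute by (simp flip: uloc_of_mult)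

lemma Ldel_inv [simp]: "Ldel1 * Ldel1_inv = 1" "Ldel2 * Ldel2_inv = 1" "Ldel1_inv * Ldel1 = 1" "Ldel2_inv * Ldel2 = 1"
proof -
  have 1: "Ldel1 * Ldel2 * del12_inv = 1" "del12_inv * (Ldel1 * Ldel2) = 1"
    using del12_inv by (simp_all add: del12_def uloc_of_mult)
  then show l: "Ldel1 * Ldel1_inv = 1" "Ldel2 * Ldel2_inv = 1"
    by (simp_all add: Ldel1_inv_def Ldel2_inv_def Ldel_commute flip: mult.assoc)
  have "del12_inv * Ldel2 * Ldel1 = 1" "del12_inv * Ldel1 * Ldel2 = 1"
    using 1(2) by (simp_all add: Ldel_commute mult.assoc)
  then have "del12_inv * Ldel2 = Ldel1_inv" "del12_inv * Ldel1 = Ldel2_inv"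
    using l by (metis mult.assoc mult_1 mult_1_right)+
  then show "Ldel1_inv * Ldel1 = 1" "Ldel2_inv * Ldel2 = 1"
    using \<open>del12_inv * Ldel2 * Ldel1 = 1\<close> \<open>del12_inv * Ldel1 * Ldel2 = 1\<close> by simp_all
qed

lemma del12_inv_conv: "del12_inv = Ldel1_inv * Ldel2_inv"
proof -
  have "Ldel1_inv * Ldel2_inv = Ldel1_inv * Ldel1 * del12_inv" by (simp only: Ldel2_inv_def mult.assoc)
  then show ?thesis by simp
qed

lemma Ldel_commute_inv:
  "Ldel1 * Ldel2_inv = Ldel2_inv * Ldel1" "Ldel2 * Ldel1_inv = Ldel1_inv * Ldel2"
proof -
  have inv_comm: "x * b = b * x" if "x * a = a * x" "a * b = 1" "b * a = 1" for x a b :: uloc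
  proof -
    have "x * b = b * a * x * b" by (simp add: that)
    also have "\<dots> = b * x * (a * b)" by (simp add: that(1) mult.assoc flip: that(1))
    finally show ?thesis by (simp add: that)
  qed
  show "Ldel1 * Ldel2_inv = Ldel2_inv * Ldel1" by (rule inv_comm[of _ Ldel2]) (simp_all add: Ldel_commute)
  show "Ldel2 * Ldel1_inv = Ldel1_inv * Ldel2" by (rule inv_comm[of _ Ldel1]) (simp_all add: Ldel_commute)
qed

section \<open>Identification with the Ore localization\<close>

lemma del_monomial_mult:
  "(Udel1 ^ i * Udel2 ^ j) * (Udel1 ^ k * Udel2 ^ l) = Udel1 ^ (i + k) * Udel2 ^ (j + l)"
proof -
  have "Udel2 ^ j * Udel1 ^ k = Udel1 ^ k * Udel2 ^ j"
    by (metis del_commute power_commuting_commutes)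
  then show ?thesis by (simp add: power_add) (metis mult.assoc)
qed

lemma del12_power: "del12 ^ n = Udel1 ^ n * Udel2 ^ n"
proof (induction n)
  case (Suc n)
  then show ?case using del_monomial_mult[of 1 1 n n] by (simp add: del12_def)
qed simp

lemma del_powers_dvd:
  assumes "s \<in> del_powers"
  shows "\<exists>v n. v * s = del12 ^ n \<and> s * v = del12 ^ n"
proof -
  obtain i j where "s = Udel1 ^ i * Udel2 ^ j" using assms by (auto simp: del_powers_def)
  then have "(Udel1 ^ j * Udel2 ^ i) * s = del12 ^ (i + j)" "s * (Udel1 ^ j * Udel2 ^ i) = del12 ^ (i + j)"
    by (simp_all only: del_monomial_mult del12_power add.commute[of i j])
  then show ?thesis by blast
qed

lemma del_powers_mult: "s \<in> del_powers \<Longrightarrow> u \<in> del_powers \<Longrightarrow> s * u \<in> del_powers"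
  using del_monomial_mult by (force simp: del_powers_def)

lemma del_powers_commute: "s \<in> del_powers \<Longrightarrow> u \<in> del_powers \<Longrightarrow> s * u = u * s"
  by (auto simp: del_powers_def del_monomial_mult add.commute)

lemma one_in_del_powers: "1 \<in> del_powers"
  unfolding del_powers_def by (intro CollectI exI[of _ 0]) simp

lemma del12_power_in_del_powers: "del12 ^ n \<in> del_powers"
proof (induction n)
  case 0
  show ?case by (simp add: one_in_del_powers)
next
  case (Suc n)
  have "del12 \<in> del_powers"
    unfolding del_powers_def del12_def by (intro CollectI exI[of _ 1]) simp
  with Suc show ?case by (simp add: del_powers_mult)
qed

lemma uloc_of_del_powers_inverse:
  assumes "s \<in> del_powers"
  obtains x where "x * uloc_of s = 1" "uloc_of s * x = 1"
proof -
  have pw: "del12_inv ^ n * uloc_of del12 ^ n = 1" "uloc_of del12 ^ n * del12_inv ^ n = 1" for n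
  proof (induction n)
    case (Suc n)
    { case 1
      have "del12_inv ^ Suc n * uloc_of del12 ^ Suc n = del12_inv ^ n * (del12_inv * uloc_of del12) * uloc_of del12 ^ n"
        unfolding power_Suc2[of del12_inv n] power_Suc[of "uloc_of del12" n] by (simp only: mult.assoc)
      then show ?case by (simp only: del12_inv Suc mult_1_right) }
    { case 2
      have "uloc_of del12 ^ Suc n * del12_inv ^ Suc n = uloc_of del12 ^ n * (uloc_of del12 * del12_inv) * del12_inv ^ n"
        unfolding power_Suc2[of "uloc_of del12" n] power_Suc[of del12_inv n] by (simp only: mult.assoc)
      then show ?case by (simp only: del12_inv Suc mult_1_right) }
  qed simp_all
  obtain v n where v: "v * s = del12 ^ n" "s * v = del12 ^ n" using del_powers_dvd[OF assms] by blast
  have "uloc_of v * uloc_of s = uloc_of del12 ^ n" "uloc_of s * uloc_of v = uloc_of del12 ^ n"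
    by (simp_all add: v flip: uloc_of_mult uloc_of_power)
  then have 1: "uloc_of s * (uloc_of v * del12_inv ^ n) = 1" "del12_inv ^ n * uloc_of v * uloc_of s = 1"
    using pw[of n] by (metis mult.assoc)+
  then have "del12_inv ^ n * uloc_of v = uloc_of v * del12_inv ^ n"
    by (metis mult.assoc mult_1 mult_1_right)
  with 1 show ?thesis using that by metis
qed

text \<open>All left fractions that represent \<open>x\<close>. This is the bridge between the ring of right fractions
  and the localization, whose elements are such sets of pairs.\<close>
definition frac_class :: "uloc \<Rightarrow> (sbar2 uea \<times> sbar2 uea) set"
  where "frac_class x = {(s, r). s \<in> del_powers \<and> uloc_of s * x = uloc_of r}"

lemma uloc_of_eq_iff: "uloc_of r = uloc_of s \<longleftrightarrow> (\<exists>N. del12 ^ N * r = del12 ^ N * s)"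
  by (simp add: uloc_of_def rfrac_0_eq_iff)

lemma del_powers_cancel:
  assumes "s \<in> del_powers" "uloc_of s * x = uloc_of s * y"
  shows "x = y"
proof -
  obtain z where "z * uloc_of s = 1" by (rule uloc_of_del_powers_inverse[OF assms(1)])
  then show ?thesis using assms(2) by (metis mult.assoc mult_1)
qed

lemma frac_class_nonempty: "\<exists>s r. (s, r) \<in> frac_class x"
proof -
  obtain n r where "left_act (del12 ^ n) x = rfrac r 0" using left_act_del12_uloc_of by blast
  then have "(del12 ^ n, r) \<in> frac_class x"
    by (simp add: frac_class_def left_act_conv_mult del12_power_in_del_powers uloc_of_def)
  then show ?thesis by blast
qed

lemma frac_class_inj: "frac_class x = frac_class y \<longleftrightarrow> x = y"
proof
  assume eq: "frac_class x = frac_class y"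
  obtain s r where "(s, r) \<in> frac_class x" using frac_class_nonempty by blast
  moreover from this have "(s, r) \<in> frac_class y" by (simp add: eq)
  ultimately show "x = y" using del_powers_cancel by (auto simp: frac_class_def)
qed simp

text \<open>The relation defining \<open>ore_frac\<close> asks for a common multiple of the denominators and is therefore
  equality of the fractions as elements of the ring. In one direction, \<open>b\<close> can be cancelled because
  \<open>b s'\<close> and \<open>s'\<close> are invertible; in the other, an equality between images of elements of \<open>U\<close> holds
  in \<open>U\<close> after multiplication by a power of \<open>\<partial>\<^sub>1\<partial>\<^sub>2\<close>.\<close>
lemma ore_frac_eq:
  assumes "s \<in> del_powers" "uloc_of s * x = uloc_of r"
  shows "ore_frac del_powers s r = frac_class x"
proof (intro equalityI subsetI)
  fix p assume "p \<in> ore_frac del_powers s r"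
  then obtain s' r' a b where p: "p = (s', r')" and s': "s' \<in> del_powers"
    and ab: "a * s = b * s'" "a * s \<in> del_powers" "a * r = b * r'"
    by (auto simp: ore_frac_def)
  obtain c where c: "c * uloc_of (b * s') = 1" "uloc_of (b * s') * c = 1"
    using ab by (metis uloc_of_del_powers_inverse)
  obtain d where d: "d * uloc_of s' = 1" "uloc_of s' * d = 1"
    using s' by (metis uloc_of_del_powers_inverse)
  have b_cancel: "y = z" if "uloc_of b * y = uloc_of b * z" for y z
  proof -
    have "c * uloc_of b * (uloc_of s' * (d * y)) = c * uloc_of b * y" for y
      by (metis d(2) mult.assoc mult_1)
    have bsc: "uloc_of b * (uloc_of s' * c) = 1" "c * uloc_of b * uloc_of s' = 1"
      using c by (simp_all add: uloc_of_mult mult.assoc)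
    have "c * uloc_of b = d" using bsc(2) d(2) by (metis mult.assoc mult_1 mult_1_right)
    then have "uloc_of s' * (c * uloc_of b) = 1" by (simp add: d)
    then show ?thesis using that by (metis mult.assoc mult_1)
  qed
  have "uloc_of b * (uloc_of s' * x) = uloc_of (a * s) * x"
    by (simp add: ab(1) uloc_of_mult mult.assoc)
  also have "\<dots> = uloc_of (a * r)"
    by (simp add: uloc_of_mult mult.assoc assms(2))
  also have "\<dots> = uloc_of b * uloc_of r'"
    by (simp add: ab(3) uloc_of_mult)
  finally show "p \<in> frac_class x" using s' b_cancel by (simp add: frac_class_def p)
next
  fix p assume "p \<in> frac_class x"
  then obtain s' r' where p: "p = (s', r')" and s': "s' \<in> del_powers"
    and x: "uloc_of s' * x = uloc_of r'" by (auto simp: frac_class_def)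
  have "uloc_of (s' * r) = uloc_of (s' * s) * x"
    by (simp add: uloc_of_mult mult.assoc assms(2))
  also have "\<dots> = uloc_of (s * r')"
    by (simp add: del_powers_commute[OF s' assms(1)] uloc_of_mult mult.assoc x)
  finally have "uloc_of (s' * r) = uloc_of (s * r')" .
  then obtain N where "del12 ^ N * (s' * r) = del12 ^ N * (s * r')" by (auto simp: uloc_of_eq_iff)
  then have "del12 ^ N * s' * s = del12 ^ N * s * s' \<and> del12 ^ N * s' * s \<in> del_powers
      \<and> del12 ^ N * s' * r = del12 ^ N * s * r'"
    using del_powers_commute[OF assms(1) s'] s' assms(1)
    by (simp add: mult.assoc del_powers_mult del12_power_in_del_powers)
  then show "p \<in> ore_frac del_powers s r"
    using s' by (auto simp: ore_frac_def p)
qed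

lemma U_loc_carrier: "carrier U_loc = range frac_class"
proof (intro equalityI subsetI)
  fix X assume "X \<in> carrier U_loc"
  then obtain s r where s: "s \<in> del_powers" and X: "X = ore_frac del_powers s r"
    by (auto simp: U_loc_def ore_localization_def)
  obtain z where "uloc_of s * z = 1" by (rule uloc_of_del_powers_inverse[OF s])
  then have "uloc_of s * (z * uloc_of r) = uloc_of r" by (simp flip: mult.assoc)
  then show "X \<in> range frac_class" using ore_frac_eq[OF s] X by blast
next
  fix X assume "X \<in> range frac_class"
  then obtain x where X: "X = frac_class x" by blast
  obtain s r where "(s, r) \<in> frac_class x" using frac_class_nonempty by blast
  then have "s \<in> del_powers" "X = ore_frac del_powers s r"
    by (auto simp: frac_class_def X ore_frac_eq)
  then show "X \<in> carrier U_loc" by (auto simp: U_loc_def ore_localization_def)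
qed

lemma loc_of_eq: "loc_of u = frac_class (uloc_of u)"
  unfolding loc_of_def by (rule ore_frac_eq) (simp_all add: one_in_del_powers)

lemma U_loc_one: "\<one>\<^bsub>U_loc\<^esub> = frac_class 1"
  by (simp add: U_loc_def ore_localization_def) (rule ore_frac_eq, simp_all add: one_in_del_powers)

lemma U_loc_zero: "\<zero>\<^bsub>U_loc\<^esub> = frac_class 0"
  by (simp add: U_loc_def ore_localization_def) (rule ore_frac_eq, simp_all add: one_in_del_powers)

lemma Union_const: "A \<noteq> {} \<Longrightarrow> (\<And>x. x \<in> A \<Longrightarrow> x = c) \<Longrightarrow> \<Union>A = c"
  by blast

text \<open>All admissible choices in the definition of the product yield the same class:
  if \<open>b r = a s'\<close>, then \<open>b s x y = b r y = a s' y = a r'\<close>.\<close>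
lemma U_loc_mult: "frac_class x \<otimes>\<^bsub>U_loc\<^esub> frac_class y = frac_class (x * y)"
proof -
  obtain s r s' r' where sr: "(s, r) \<in> frac_class x" "(s', r') \<in> frac_class y"
    using frac_class_nonempty by metis
  then have s': "s' \<in> del_powers" by (simp add: frac_class_def)
  obtain v n where v: "v * s' = del12 ^ n" using del_powers_dvd[OF s'] by blast
  obtain N w where w: "del12 ^ N * r = w * del12 ^ n" using del12_ore_left by blast
  have ex: "del12 ^ N \<in> del_powers \<and> del12 ^ N * r = (w * v) * s'"
    by (simp add: del12_power_in_del_powers w v mult.assoc)
  show ?thesis
    unfolding U_loc_def ore_localization_def monoid.simps
  proof (rule Union_const)
    show "{ore_frac del_powers (b * s) (a * r') |s r s' r' a b. (s, r) \<in> frac_class x \<and>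
      (s', r') \<in> frac_class y \<and> b \<in> del_powers \<and> b * r = a * s'} \<noteq> {}"
      using sr ex by blast
  next
    fix X assume "X \<in> {ore_frac del_powers (b * s) (a * r') |s r s' r' a b. (s, r) \<in> frac_class x \<and>
      (s', r') \<in> frac_class y \<and> b \<in> del_powers \<and> b * r = a * s'}"
    then obtain s r s' r' a b where X: "X = ore_frac del_powers (b * s) (a * r')"
      and s: "s \<in> del_powers" "uloc_of s * x = uloc_of r"
      and s': "s' \<in> del_powers" "uloc_of s' * y = uloc_of r'"
      and b: "b \<in> del_powers" "b * r = a * s'"
      by (auto simp: frac_class_def)
    have "uloc_of (b * s) * (x * y) = uloc_of b * (uloc_of s * x) * y"
      by (simp add: uloc_of_mult mult.assoc)
    also have "\<dots> = uloc_of (a * s') * y" by (simp add: s b(2) flip: uloc_of_mult)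
    also have "\<dots> = uloc_of (a * r')" by (simp add: s' uloc_of_mult mult.assoc)
    finally show "X = frac_class (x * y)"
      unfolding X using b s by (intro ore_frac_eq del_powers_mult)
  qed
qed

lemma U_loc_add: "frac_class x \<oplus>\<^bsub>U_loc\<^esub> frac_class y = frac_class (x + y)"
proof -
  obtain s r s' r' where sr: "(s, r) \<in> frac_class x" "(s', r') \<in> frac_class y"
    using frac_class_nonempty by metis
  then have "s' * s = s * s' \<and> s' * s \<in> del_powers"
    by (simp add: frac_class_def del_powers_mult del_powers_commute)
  with sr have ex: "\<exists>X a b. X = ore_frac del_powers (a * s) (a * r + b * r') \<and> (s, r) \<in> frac_class x \<and>
      (s', r') \<in> frac_class y \<and> a * s = b * s' \<and> a * s \<in> del_powers" by blast
  show ?thesis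
    unfolding U_loc_def ore_localization_def ring.simps
  proof (rule Union_const)
    show "{ore_frac del_powers (a * s) (a * r + b * r') |s r s' r' a b. (s, r) \<in> frac_class x \<and>
      (s', r') \<in> frac_class y \<and> a * s = b * s' \<and> a * s \<in> del_powers} \<noteq> {}"
      using ex by blast
  next
    fix X assume "X \<in> {ore_frac del_powers (a * s) (a * r + b * r') |s r s' r' a b.
      (s, r) \<in> frac_class x \<and> (s', r') \<in> frac_class y \<and> a * s = b * s' \<and> a * s \<in> del_powers}"
    then obtain s r s' r' a b where X: "X = ore_frac del_powers (a * s) (a * r + b * r')"
      and s: "s \<in> del_powers" "uloc_of s * x = uloc_of r"
      and s': "s' \<in> del_powers" "uloc_of s' * y = uloc_of r'"
      and ab: "a * s = b * s'" "a * s \<in> del_powers"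
      by (auto simp: frac_class_def)
    have "uloc_of (a * s) * x = uloc_of (a * r)" "uloc_of (b * s') * y = uloc_of (b * r')"
      by (simp_all add: s s' uloc_of_mult mult.assoc)
    then have "uloc_of (a * s) * (x + y) = uloc_of (a * r + b * r')"
      by (simp add: distrib_left uloc_of_add ab(1))
    then show "X = frac_class (x + y)"
      unfolding X using ab by (intro ore_frac_eq)
  qed
qed

lemma U_loc_smult: "c \<odot>\<^bsub>U_loc\<^esub> frac_class x = frac_class (c *\<^sub>C x)"
proof -
  have ex: "\<exists>s r. (s, r) \<in> frac_class x" using frac_class_nonempty by blast
  show ?thesis
    unfolding U_loc_def ore_localization_def module.simps
  proof (rule Union_const)
    show "{ore_frac del_powers s (c *\<^sub>C r) |s r. (s, r) \<in> frac_class x} \<noteq> {}"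
      using ex by blast
  next
    fix X assume "X \<in> {ore_frac del_powers s (c *\<^sub>C r) |s r. (s, r) \<in> frac_class x}"
    then obtain s r where X: "X = ore_frac del_powers s (c *\<^sub>C r)"
      and s: "s \<in> del_powers" "uloc_of s * x = uloc_of r"
      by (auto simp: frac_class_def)
    have "uloc_of s * (c *\<^sub>C x) = uloc_of (c *\<^sub>C r)"
      by (simp add: uloc_scaleC_mult_right s uloc_of_scaleC)
    then show "X = frac_class (c *\<^sub>C x)"
      unfolding X using s by (intro ore_frac_eq)
  qed
qed

lemma U_loc_minus: "frac_class x \<ominus>\<^bsub>U_loc\<^esub> frac_class y = frac_class (x - y)"
proof -
  have "\<ominus>\<^bsub>U_loc\<^esub> frac_class y = frac_class (- y)"
    unfolding a_inv_def m_inv_def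
    by (rule the_equality)
       (auto simp: U_loc_carrier U_loc_add U_loc_zero frac_class_inj add_eq_0_iff)
  then show ?thesis by (simp add: a_minus_def U_loc_add)
qed

text \<open>The algebra \<open>H\<close>, seen inside the ring of fractions.\<close>
definition uloc_centralizer :: "uloc set"
  where "uloc_centralizer = {x. \<forall>X\<in>{del1, del2, d1, d2}. x * uloc_of (uea_of X) = uloc_of (uea_of X) * x}"

lemma H_carrier: "carrier H = frac_class ` uloc_centralizer"
  by (auto simp: H_def U_loc_carrier loc_of_eq U_loc_mult U_loc_minus U_loc_zero frac_class_inj
      uloc_centralizer_def)

lemma H_ops:
  "frac_class x \<otimes>\<^bsub>H\<^esub> frac_class y = frac_class (x * y)"
  "frac_class x \<oplus>\<^bsub>H\<^esub> frac_class y = frac_class (x + y)"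
  "c \<odot>\<^bsub>H\<^esub> frac_class x = frac_class (c *\<^sub>C x)"
  "\<one>\<^bsub>H\<^esub> = frac_class 1"
  using U_loc_mult U_loc_add U_loc_smult U_loc_one by (simp_all add: H_def)

section \<open>Weights\<close>

lemma pd2_t1: "pd2 t1 = 0" and pd1_t2: "pd1 t2 = 0"
  by (simp add: pd2_def t1_def pderiv_pCons)
     (rule poly_eqI, simp add: coeff_pd1 t2_def coeff_pCons split: nat.split)

lemma pd1_monom: "pd1 (monom (monom c i) j) = monom (monom (of_nat i * c) (i - 1)) j"
  by (rule poly_eqI) (simp add: coeff_pd1 pderiv_monom)

lemma pd2_monom: "pd2 (monom (monom c i) j) = monom (monom (of_nat j * c) i) (j - 1)"
  by (simp add: pd2_def pderiv_monom of_nat_poly smult_monom)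

text \<open>Euler's identity for the operators \<open>t\<^sub>i \<partial>\<^sub>i\<close>, which makes \<open>ad d\<^sub>i\<close> diagonal on monomial vector
  fields.\<close>
lemma t1_pd1_monom: "t1 * pd1 (monom (monom c i) j) = Polynomial.smult [:of_nat i:] (monom (monom c i) j)"
  by (cases i) (simp_all add: pd1_monom t1_def smult_monom flip: monom_Suc)

lemma t2_pd2_monom: "t2 * pd2 (monom (monom c i) j) = Polynomial.smult [:of_nat j:] (monom (monom c i) j)"
  by (cases j) (simp_all add: pd2_monom t2_def smult_monom flip: monom_Suc)

lemma components_lie_d:
  "components (lie d1 X) = (case components X of (p, q) \<Rightarrow> (t1 * pd1 p - p, t1 * pd1 q))"
  "components (lie d2 X) = (case components X of (p, q) \<Rightarrow> (t2 * pd2 p, t2 * pd2 q - q))"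
  by (transfer; clarsimp simp: pd2_t1 pd1_t2)+

lemma components_sum:
  "components (\<Sum>k\<in>A. f k) = (\<Sum>k\<in>A. fst (components (f k)), \<Sum>k\<in>A. snd (components (f k)))"
  by (induction A rule: infinite_finite_induct)
    (simp_all add: zero_sbar2.rep_eq plus_sbar2.rep_eq case_prod_beta)

definition sbar2_weight :: "int \<Rightarrow> int \<Rightarrow> sbar2 \<Rightarrow> bool"
  where "sbar2_weight a b X \<longleftrightarrow> lie d1 X = of_int a *\<^sub>C X \<and> lie d2 X = of_int b *\<^sub>C X"

lemma coeff_coeff_double_sum_monom:
  assumes "finite A" "finite B"
  shows "coeff (coeff (\<Sum>i\<in>A. \<Sum>j\<in>B. monom (monom (c i j) i) j) m) n
    = (if n \<in> A \<and> m \<in> B then c n m else (0::complex))"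
proof -
  have "coeff (coeff (\<Sum>i\<in>A. \<Sum>j\<in>B. monom (monom (c i j) i) j) m) n
      = (\<Sum>i\<in>A. \<Sum>j\<in>B. if j = m then (if i = n then c n m else 0) else 0)"
    unfolding coeff_sum by (intro sum.cong) auto
  also have "\<dots> = (if n \<in> A \<and> m \<in> B then c n m else 0)"
    using assms by (cases "m \<in> B") (auto simp: sum.delta)
  finally show ?thesis .
qed

lemma bidegree_bound: "\<exists>N. \<forall>i j. coeff (coeff (p :: cpoly2) j) i \<noteq> 0 \<longrightarrow> i < N \<and> j < N"
proof -
  define N where "N = Suc (degree p + (\<Sum>j\<le>degree p. degree (coeff p j)))"
  have "i < N \<and> j < N" if "coeff (coeff p j) i \<noteq> 0" for i j
  proof -
    have "coeff p j \<noteq> 0" using that by auto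
    then have j: "j \<le> degree p" by (rule le_degree)
    have "i \<le> degree (coeff p j)" using that by (rule le_degree)
    also have "\<dots> \<le> (\<Sum>j\<le>degree p. degree (coeff p j))" using j by (intro member_le_sum) auto
    finally show ?thesis using j by (simp add: N_def)
  qed
  then show ?thesis by blast
qed

text \<open>The component of weight \<open>(i - 1, j - 1)\<close> of \<open>p \<partial>\<^sub>1 + q \<partial>\<^sub>2\<close> consists of the monomial
  \<open>t\<^sub>1\<^sup>i t\<^sub>2\<^sup>j\<^sup>-\<^sup>1\<close> of \<open>p\<close> and the monomial \<open>t\<^sub>1\<^sup>i\<^sup>-\<^sup>1 t\<^sub>2\<^sup>j\<close> of \<open>q\<close>. Its divergence is the
  \<open>t\<^sub>1\<^sup>i\<^sup>-\<^sup>1 t\<^sub>2\<^sup>j\<^sup>-\<^sup>1\<close>-part of the divergence of the whole field, hence constant, so the components stay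
  inside the Lie algebra. The indices are shifted by one because \<open>\<partial>\<^sub>i\<close> has weight \<open>-1\<close>.\<close>
lemma sbar2_sum_weights:
  obtains N f where "X = (\<Sum>i<N. \<Sum>j<N. f i j)"
    "\<And>i j. sbar2_weight (int i - 1) (int j - 1) (f i j)"
proof -
  obtain p q where X: "components X = (p, q)" by fastforce
  obtain c where div: "pd1 p + pd2 q = [:[:c:]:]"
    using components[of X] by (auto simp: X)
  define P where "P i j = (if j = 0 then 0 else monom (monom (coeff (coeff p (j - 1)) i) i) (j - 1))" for i j
  define Q where "Q i j = (if i = 0 then 0 else monom (monom (coeff (coeff q j) (i - 1)) (i - 1)) j)" for i j
  have "\<exists>c. pd1 (P i j) + pd2 (Q i j) = [:[:c:]:]" for i j
  proof (cases "i = 0 \<or> j = 0")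
    case True
    then have "pd1 (P i j) + pd2 (Q i j) = [:[:0:]:]"
      by (auto simp: P_def Q_def pd1_monom pd2_monom)
    then show ?thesis by blast
  next
    case False
    then obtain a b where ab: "i = Suc a" "j = Suc b" by (meson not0_implies_Suc)
    have "coeff (coeff (pd1 p + pd2 q) b) a
        = of_nat (Suc a) * coeff (coeff p b) (Suc a) + of_nat (Suc b) * coeff (coeff q (Suc b)) a"
      by (simp add: coeff_pd1 pd2_def coeff_pderiv of_nat_poly algebra_simps)
    then have "pd1 (P i j) + pd2 (Q i j) = monom (monom (coeff (coeff (pd1 p + pd2 q) b) a) a) b"
      by (simp add: P_def Q_def ab pd1_monom pd2_monom add_monom)
    also have "\<dots> = [:[:if a = 0 \<and> b = 0 then c else 0:]:]"
      unfolding div by (cases a; cases b) (simp_all add: monom_0)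
    finally show ?thesis by blast
  qed
  then have comp: "components (vfield (P i j, Q i j)) = (P i j, Q i j)" for i j
    by (intro vfield_inverse) auto
  \<comment> \<open>In the direction of the field itself, the bracket contributes an extra \<open>-1\<close> to the Euler degree.\<close>
  have shift: "Polynomial.smult [:c - 1:] r = Polynomial.smult [:c:] r - r" for c :: complex and r
  proof -
    have "[:c - 1:] = [:c:] - (1 :: complex poly)" by (simp add: one_pCons)
    then show ?thesis by (simp only: smult_diff_left smult_1_left)
  qed
  have "t1 * pd1 (P i j) = Polynomial.smult [:of_nat i:] (P i j)"
    "t2 * pd2 (P i j) = Polynomial.smult [:of_nat j - 1:] (P i j)"
    "t1 * pd1 (Q i j) = Polynomial.smult [:of_nat i - 1:] (Q i j)"
    "t2 * pd2 (Q i j) = Polynomial.smult [:of_nat j:] (Q i j)" for i j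
    by (auto simp: P_def Q_def t1_pd1_monom t2_pd2_monom of_nat_diff)
  then have wt: "sbar2_weight (int i - 1) (int j - 1) (vfield (P i j, Q i j))" for i j
    unfolding sbar2_weight_def components_inject[symmetric]
    by (simp add: components_lie_d scaleC_sbar2.rep_eq comp shift)
  obtain N1 where N1: "\<And>i j. coeff (coeff p j) i \<noteq> 0 \<Longrightarrow> i < N1 \<and> j < N1" using bidegree_bound by metis
  obtain N2 where N2: "\<And>i j. coeff (coeff q j) i \<noteq> 0 \<Longrightarrow> i < N2 \<and> j < N2" using bidegree_bound by metis
  define N where "N = Suc (N1 + N2)"
  have "(\<Sum>i<N. \<Sum>j<N. P i j) = (\<Sum>i<N. \<Sum>j<N1 + N2. monom (monom (coeff (coeff p j) i) i) j)"
    unfolding N_def sum.lessThan_Suc_shift[of _ "N1 + N2"] by (simp add: P_def)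
  also have "\<dots> = p"
  proof (intro poly_eqI)
    fix m n
    show "coeff (coeff (\<Sum>i<N. \<Sum>j<N1 + N2. monom (monom (coeff (coeff p j) i) i) j) m) n
        = coeff (coeff p m) n"
      unfolding coeff_coeff_double_sum_monom[OF finite_lessThan finite_lessThan]
      using N1[of m n] by (cases "coeff (coeff p m) n = 0") (auto simp: N_def)
  qed
  finally have p: "(\<Sum>i<N. \<Sum>j<N. P i j) = p" .
  have "(\<Sum>i<N. \<Sum>j<N. Q i j) = (\<Sum>i<N1 + N2. \<Sum>j<N. monom (monom (coeff (coeff q j) i) i) j)"
    unfolding N_def sum.lessThan_Suc_shift[of "\<lambda>i. \<Sum>j<Suc (N1 + N2). Q i j" "N1 + N2"] by (simp add: Q_def)
  also have "\<dots> = q"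
  proof (intro poly_eqI)
    fix m n
    show "coeff (coeff (\<Sum>i<N1 + N2. \<Sum>j<N. monom (monom (coeff (coeff q j) i) i) j) m) n
        = coeff (coeff q m) n"
      unfolding coeff_coeff_double_sum_monom[OF finite_lessThan finite_lessThan]
      using N2[of m n] by (cases "coeff (coeff q m) n = 0") (auto simp: N_def)
  qed
  finally have q: "(\<Sum>i<N. \<Sum>j<N. Q i j) = q" .
  have "X = (\<Sum>i<N. \<Sum>j<N. vfield (P i j, Q i j))"
    unfolding components_inject[symmetric] by (simp add: components_sum comp p q X)
  then show ?thesis by (rule that) (rule wt)
qed

abbreviation "Ld1 \<equiv> uloc_of (uea_of d1)"
abbreviation "Ld2 \<equiv> uloc_of (uea_of d2)"

definition weight :: "int \<Rightarrow> int \<Rightarrow> uloc \<Rightarrow> bool"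
  where "weight a b x \<longleftrightarrow> Ld1 * x - x * Ld1 = of_int a *\<^sub>C x \<and> Ld2 * x - x * Ld2 = of_int b *\<^sub>C x"

lemma scaleC_minus_right: "c *\<^sub>C (- x) = - (c *\<^sub>C (x::'a::complex_vector))"
  using scaleC_add_right[of c x "- x"] by (simp add: eq_neg_iff_add_eq_0 add.commute)

lemma scaleC_minus_left: "(- c) *\<^sub>C x = - (c *\<^sub>C (x::'a::complex_vector))"
  using scaleC_add_left[of c "- c" x] by (simp add: eq_neg_iff_add_eq_0 add.commute)

lemma scaleC_diff_right: "c *\<^sub>C (x - y) = c *\<^sub>C x - c *\<^sub>C (y::'a::complex_vector)"
  using scaleC_add_right[of c x "- y"] by (simp add: scaleC_minus_right)

lemma scaleC_diff_left: "(c - d) *\<^sub>C x = c *\<^sub>C x - d *\<^sub>C (x::'a::complex_vector)"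
  using scaleC_add_left[of c "- d" x] by (simp add: scaleC_minus_left)

lemma weight_sbar2: "sbar2_weight a b X \<Longrightarrow> weight a b (uloc_of (uea_of X))"
  unfolding sbar2_weight_def weight_def
  by (simp flip: uloc_of_mult uloc_of_diff uea_of_lie add: uea_of_scaleC uloc_of_scaleC)

lemma weight_zero [simp]: "weight a b 0"
  by (simp add: weight_def)

lemma weight_add: "weight a b x \<Longrightarrow> weight a b y \<Longrightarrow> weight a b (x + y)"
  by (simp add: weight_def distrib_left distrib_right scaleC_add_right algebra_simps)

lemma weight_uminus: "weight a b x \<Longrightarrow> weight a b (- x)"
  by (simp add: weight_def scaleC_minus_right) (metis minus_diff_eq)

lemma commutator_mult: "f * (x * y) - x * y * f = (f * x - x * f) * y + x * (f * y - y * (f::'a::ring))"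
  by (simp add: algebra_simps)

lemma weight_mult: "weight a b x \<Longrightarrow> weight c d y \<Longrightarrow> weight (a + c) (b + d) (x * y)"
  by (simp add: weight_def commutator_mult[of Ld1 x] commutator_mult[of Ld2 x] scaleC_add_left
      uloc_scaleC_mult_left uloc_scaleC_mult_right)

lemma weight_one: "weight 0 0 1"
  by (simp add: weight_def)

lemma weight_inverse:
  assumes "weight a b x" "x * y = 1" "y * x = 1"
  shows "weight (- a) (- b) y"
proof -
  have "f * y - y * f = - (c *\<^sub>C y)" if "f * x - x * f = c *\<^sub>C x" for f c
  proof -
    have "f * y - y * f = - (y * (f * x - x * f) * y)"
      using assms(2,3) by (simp add: right_diff_distrib left_diff_distrib mult.assoc)
        (simp flip: mult.assoc)
    then show ?thesis
      using that assms(2,3) by (simp add: uloc_scaleC_mult_left uloc_scaleC_mult_right)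
  qed
  then show ?thesis using assms(1) by (simp add: weight_def scaleC_minus_left)
qed

lemma sbar2_weight_del: "sbar2_weight (- 1) 0 del1" "sbar2_weight 0 (- 1) del2"
  unfolding sbar2_weight_def components_inject[symmetric]
  by (simp_all add: components_lie_d scaleC_sbar2.rep_eq del1.rep_eq del2.rep_eq zero_sbar2.rep_eq one_pCons)

lemma weight_Ldel: "weight (- 1) 0 Ldel1" "weight 0 (- 1) Ldel2" "weight 1 0 Ldel1_inv" "weight 0 1 Ldel2_inv"
  using weight_sbar2[OF sbar2_weight_del(1)] weight_sbar2[OF sbar2_weight_del(2)]
    weight_inverse[of "- 1" 0 Ldel1 Ldel1_inv] weight_inverse[of 0 "- 1" Ldel2 Ldel2_inv] by simp_all

text \<open>The power \<open>x\<^sup>k\<close> of a unit with inverse \<open>y\<close>; the inverse has to be passed explicitly, because the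
  ring of fractions is not a division ring.\<close>
definition zpow :: "'a::monoid_mult \<Rightarrow> 'a \<Rightarrow> int \<Rightarrow> 'a"
  where "zpow x y k = (if 0 \<le> k then x ^ nat k else y ^ nat (- k))"

lemma zpow_0 [simp]: "zpow x y 0 = 1"
  by (simp add: zpow_def)

lemma zpow_rec:
  assumes "x * y = 1"
  shows "x * zpow x y k = zpow x y (k + 1)"
proof (cases "0 \<le> k")
  case True
  then show ?thesis by (simp add: zpow_def nat_add_distrib)
next
  case False
  then obtain n where n: "k = - int (Suc n)" by (metis le_less_linear negD)
  have "x * y ^ Suc n = y ^ n" by (simp add: assms flip: mult.assoc)
  then show ?thesis by (auto simp: zpow_def n nat_add_distrib)
qed

lemma zpow_rec':
  assumes "x * y = 1" "y * x = 1"
  shows "y * zpow x y k = zpow x y (k - 1)"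
  using zpow_rec[OF assms(1), of "k - 1"] assms(2) by (metis diff_add_cancel mult.assoc mult_1)

abbreviation "Ldel1_zpow \<equiv> zpow Ldel1 Ldel1_inv"
abbreviation "Ldel2_zpow \<equiv> zpow Ldel2 Ldel2_inv"

lemma zpow_induct [case_names one mult inverse]:
  assumes "P 0 1" "\<And>k z. P k z \<Longrightarrow> P (k + 1) (x * z)" "\<And>k z. P k z \<Longrightarrow> P (k - 1) (y * z)"
    and "x * y = 1" "y * x = 1"
  shows "P k (zpow x y k)"
proof (induction k rule: int_induct[of _ 0])
  case base
  show ?case using assms(1) by simp
next
  case (step1 i)
  then show ?case using assms(2) by (simp flip: zpow_rec[OF assms(4)])
next
  case (step2 i)
  then show ?case using assms(3) by (simp flip: zpow_rec'[OF assms(4,5)])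
qed

lemma weight_zpow: "weight (- k) 0 (Ldel1_zpow k)" "weight 0 (- k) (Ldel2_zpow k)"
proof -
  show "weight (- k) 0 (Ldel1_zpow k)"
  proof (rule zpow_induct[where P = "\<lambda>k z. weight (- k) 0 z"])
    have k: "- (k + 1) = - 1 + - k" "- (k - 1) = 1 + - k" for k :: int by simp_all
    show "weight (- (k + 1)) 0 (Ldel1 * z)" "weight (- (k - 1)) 0 (Ldel1_inv * z)"
      if "weight (- k) 0 z" for k z
      using weight_mult[OF weight_Ldel(1) that] weight_mult[OF weight_Ldel(3) that]
      by (simp_all only: k add_0_right)
  qed (simp_all add: weight_one)
  show "weight 0 (- k) (Ldel2_zpow k)"
  proof (rule zpow_induct[where P = "\<lambda>k z. weight 0 (- k) z"])
    have k: "- (k + 1) = - 1 + - k" "- (k - 1) = 1 + - k" for k :: int by simp_all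
    show "weight 0 (- (k + 1)) (Ldel2 * z)" "weight 0 (- (k - 1)) (Ldel2_inv * z)"
      if "weight 0 (- k) z" for k z
      using weight_mult[OF weight_Ldel(2) that] weight_mult[OF weight_Ldel(4) that]
      by (simp_all only: k add_0_right)
  qed (simp_all add: weight_one)
qed

lemma Ldel2_commute_zpow: "Ldel2 * Ldel1_zpow k = Ldel1_zpow k * Ldel2"
proof (rule zpow_induct[where P = "\<lambda>k z. Ldel2 * z = z * Ldel2"])
  show "Ldel2 * (Ldel1 * z) = Ldel1 * z * Ldel2" if "Ldel2 * z = z * Ldel2" for z
    using that by (metis Ldel_commute mult.assoc)
  show "Ldel2 * (Ldel1_inv * z) = Ldel1_inv * z * Ldel2" if "Ldel2 * z = z * Ldel2" for z
    using that by (metis Ldel_commute_inv(2) mult.assoc)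
qed simp_all

section \<open>Projection onto weight zero\<close>

text \<open>The projection \<open>\<Sum> x\<^sub>a\<^sub>b \<mapsto> \<Sum> x\<^sub>a\<^sub>b \<partial>\<^sub>1\<^sup>a \<partial>\<^sub>2\<^sup>b\<close> onto weight zero, where \<open>x\<^sub>a\<^sub>b\<close> has weight \<open>(a, b)\<close>. It is
  introduced as a relation generated by homogeneous elements and sums: this makes totality and the
  compatibility with \<open>\<partial>\<^sub>1, \<partial>\<^sub>2\<close> simple inductions, and single-valuedness becomes the independence
  of the weight spaces.\<close>
inductive weight0_proj :: "uloc \<Rightarrow> uloc \<Rightarrow> bool" where
  weight: "weight a b x \<Longrightarrow> weight0_proj x (x * Ldel1_zpow a * Ldel2_zpow b)"
| add: "weight0_proj x y \<Longrightarrow> weight0_proj x' y' \<Longrightarrow> weight0_proj (x + x') (y + y')"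

lemma weight0_proj_zero: "weight0_proj 0 0"
  using weight0_proj.weight[OF weight_zero] by simp

lemma weight0_proj_self: "weight 0 0 x \<Longrightarrow> weight0_proj x x"
  using weight0_proj.weight[of 0 0 x] by simp

lemma weight0_proj_weight: "weight0_proj x y \<Longrightarrow> weight 0 0 y"
proof (induction rule: weight0_proj.induct)
  case (weight a b x)
  have "weight (a + (- a) + 0) (b + 0 + (- b)) (x * Ldel1_zpow a * Ldel2_zpow b)"
    by (intro weight_mult weight weight_zpow)
  then show ?case by simp
qed (rule weight_add)

lemma weight0_proj_uminus: "weight0_proj x y \<Longrightarrow> weight0_proj (- x) (- y)"
proof (induction rule: weight0_proj.induct)
  case (weight a b x)
  from weight0_proj.weight[OF weight_uminus[OF this]] show ?case by simp
next
  case (add x y x' y')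
  from weight0_proj.add[OF add.IH] show ?case by simp
qed

lemma weight0_proj_diff: "weight0_proj x y \<Longrightarrow> weight0_proj x' y' \<Longrightarrow> weight0_proj (x - x') (y - y')"
  using weight0_proj.add[OF _ weight0_proj_uminus] by fastforce

text \<open>Multiplying a homogeneous \<open>x\<close> by \<open>\<partial>\<^sub>i\<close> lowers the weight by one, so that one factor \<open>\<partial>\<^sub>i\<close> less is
  needed to return to weight zero. This invariance is what makes the projection vanish on the
  kernel of the map to \<open>Q\<^sub>1\<close>.\<close>
lemma weight0_proj_mult_Ldel: 
  assumes "weight0_proj x y"
  shows "weight0_proj (x * Ldel1) y" "weight0_proj (x * Ldel2) y"
proof -
  show "weight0_proj (x * Ldel1) y" using assms
  proof (induction rule: weight0_proj.induct)
    case (weight a b x)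
    have "weight (a - 1) b (x * Ldel1)" using weight_mult[OF weight weight_Ldel(1)] by simp
    from weight0_proj.weight[OF this] show ?case
      using zpow_rec[of Ldel1 Ldel1_inv "a - 1"] by (simp add: mult.assoc)
  qed (simp add: distrib_right weight0_proj.add)
  show "weight0_proj (x * Ldel2) y" using assms
  proof (induction rule: weight0_proj.induct)
    case (weight a b x)
    have "weight a (b - 1) (x * Ldel2)" using weight_mult[OF weight weight_Ldel(2)] by simp
    from weight0_proj.weight[OF this]
    have "weight0_proj (x * Ldel2) (x * (Ldel2 * Ldel1_zpow a) * Ldel2_zpow (b - 1))" by (simp add: mult.assoc)
    also have "x * (Ldel2 * Ldel1_zpow a) * Ldel2_zpow (b - 1) = x * Ldel1_zpow a * (Ldel2 * Ldel2_zpow (b - 1))"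
      by (simp only: Ldel2_commute_zpow mult.assoc)
    also have "Ldel2 * Ldel2_zpow (b - 1) = Ldel2_zpow b"
      using zpow_rec[of Ldel2 Ldel2_inv "b - 1"] by simp
    finally show ?case .
  qed (simp add: distrib_right weight0_proj.add)
qed

lemma weight0_proj_mult_total:
  assumes "weight0_proj x y" "weight0_proj x' y'"
  shows "\<exists>z. weight0_proj (x * x') z"
  using assms(1)
proof (induction rule: weight0_proj.induct)
  case (weight a b x)
  note x = weight
  show ?case using assms(2)
  proof (induction rule: weight0_proj.induct)
    case (weight c d x')
    then show ?case using weight0_proj.weight[OF weight_mult[OF x weight]] by blast
  next
    case (add x1 y1 x2 y2)
    then show ?case using weight0_proj.add by (fastforce simp: distrib_left)
  qed
next
  case (add x1 y1 x2 y2)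
  then show ?case using weight0_proj.add by (fastforce simp: distrib_right)
qed

lemma weight0_proj_sum:
  "(\<And>k. k \<in> A \<Longrightarrow> \<exists>y. weight0_proj (f k) y) \<Longrightarrow> \<exists>y. weight0_proj (\<Sum>k\<in>A. f k) y"
proof (induction A rule: infinite_finite_induct)
  case (insert x F)
  then obtain y y' where "weight0_proj (f x) y" "weight0_proj (sum f F) y'" by blast
  from weight0_proj.add[OF this] insert(1,2) show ?case by auto
qed (use weight0_proj_zero in auto)

lemma uloc_of_sum: "uloc_of (uea_of (\<Sum>k\<in>A. f k)) = (\<Sum>k\<in>A. uloc_of (uea_of (f k)))"
  by (induction A rule: infinite_finite_induct) (simp_all add: uea_of_add uloc_of_add)

lemma weight0_proj_uloc_of: "\<exists>y. weight0_proj (uloc_of u) y"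
proof (induction u rule: uea_induct)
  case (const c)
  have "weight 0 0 (uloc_of (c *\<^sub>C 1))"
    by (simp add: weight_def uloc_of_scaleC uloc_scaleC_mult_left uloc_scaleC_mult_right)
  then show ?case using weight0_proj.weight by blast
next
  case (of X)
  obtain N f where X: "X = (\<Sum>i<N. \<Sum>j<N. f i j)"
    and f: "\<And>i j. sbar2_weight (int i - 1) (int j - 1) (f i j)" using sbar2_sum_weights[of X] by blast
  show ?case
    unfolding X uloc_of_sum
    by (intro weight0_proj_sum exI) (rule weight0_proj.weight[OF weight_sbar2[OF f]])
next
  case (add u v)
  then show ?case using weight0_proj.add by (fastforce simp: uloc_of_add)
next
  case (mult u v)
  then show ?case using weight0_proj_mult_total by (fastforce simp: uloc_of_mult)
qed

text \<open>The homogeneous elements span: \<open>U\<close> is generated by homogeneous vector fields, and the inverses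
  of \<open>\<partial>\<^sub>1, \<partial>\<^sub>2\<close> are homogeneous.\<close>
lemma weight0_proj_total: "\<exists>y. weight0_proj x y"
proof -
  obtain r n where x: "x = uloc_of r * del12_inv ^ n" by (metis rfrac_cases rfrac_conv_mult)
  have del12: "\<exists>y. weight0_proj del12_inv y"
    using weight0_proj.weight[OF weight_mult[OF weight_Ldel(3,4)]] by (auto simp: del12_inv_conv)
  have "\<exists>y. weight0_proj (del12_inv ^ n) y"
  proof (induction n)
    case 0
    show ?case using weight0_proj_self[OF weight_one] by auto
  next
    case (Suc n)
    then show ?case using del12 weight0_proj_mult_total by fastforce
  qed
  then show ?thesis using weight0_proj_uloc_of weight0_proj_mult_total x by blast
qed

text \<open>The usual argument: apply \<open>ad f - e\<^sub>j\<close> to a vanishing sum to eliminate the \<open>j\<close>-th summand.\<close>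
lemma ad_eigenvectors_independent:
  fixes v :: "'k \<Rightarrow> uloc"
  assumes "finite F" "inj_on e F" "\<And>k. k \<in> F \<Longrightarrow> f * v k - v k * f = e k *\<^sub>C v k"
    and "(\<Sum>k\<in>F. v k) = 0" "k \<in> F"
  shows "v k = 0"
  using assms
proof (induction F arbitrary: v k rule: finite_induct)
  case (insert j F)
  define w where "w k = (e k - e j) *\<^sub>C v k" for k
  have "(\<Sum>k\<in>insert j F. e k *\<^sub>C v k) = f * (\<Sum>k\<in>insert j F. v k) - (\<Sum>k\<in>insert j F. v k) * f"
    using insert.prems(2) by (simp add: sum_distrib_left sum_distrib_right flip: sum_subtractf)
  then have "(\<Sum>k\<in>insert j F. e k *\<^sub>C v k) = 0" by (simp only: insert.prems(3)) simp
  moreover have "(\<Sum>k\<in>A. e j *\<^sub>C v k) = e j *\<^sub>C (\<Sum>k\<in>A. v k)" for A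
    by (induction A rule: infinite_finite_induct) (simp_all add: scaleC_add_right)
  ultimately have "(\<Sum>k\<in>insert j F. w k) = 0"
    by (simp only: w_def scaleC_diff_left sum_subtractf insert.prems(3)) simp
  then have "(\<Sum>k\<in>F. w k) = 0" using insert.hyps by (simp add: w_def)
  moreover have "f * w k - w k * f = e k *\<^sub>C w k" if "k \<in> F" for k
  proof -
    have "f * w k - w k * f = (e k - e j) *\<^sub>C (f * v k - v k * f)"
      by (simp add: w_def uloc_scaleC_mult_left uloc_scaleC_mult_right scaleC_diff_right)
    then show ?thesis using insert.prems(2) that by (simp add: w_def scaleC_scaleC mult.commute)
  qed
  ultimately have w: "w k = 0" if "k \<in> F" for k
    using insert.IH[of w] insert.prems(1) that by simp
  have vF: "v k = 0" if "k \<in> F" for k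
  proof -
    have ne: "e k - e j \<noteq> 0" using insert.hyps(2) insert.prems(1) that by (auto simp: inj_on_def)
    have "v k = inverse (e k - e j) *\<^sub>C w k" using ne by (simp add: w_def scaleC_scaleC scaleC_one)
    then show ?thesis using w[OF that] by simp
  qed
  moreover from this have "v j = 0" using insert.prems(3) insert.hyps by simp
  ultimately show ?case using insert.prems(4) by auto
qed simp

text \<open>The single element \<open>d\<^sub>1 + \<i> d\<^sub>2\<close> separates all weights, since \<open>(a, b)\<close> becomes the eigenvalue
  \<open>a + \<i> b\<close>.\<close>
lemma weights_independent:
  assumes "finite F" "\<And>a b. (a, b) \<in> F \<Longrightarrow> weight a b (v (a, b))" "(\<Sum>k\<in>F. v k) = 0" "k \<in> F"
  shows "v k = 0"
proof (rule ad_eigenvectors_independent[OF assms(1) _ _ assms(3,4)])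
  let ?e = "\<lambda>(a, b). of_int a + \<i> * of_int b :: complex"
  show "inj_on ?e F"
    by (rule inj_onI) (auto simp: complex_eq_iff)
  show "(Ld1 + \<i> *\<^sub>C Ld2) * v k - v k * (Ld1 + \<i> *\<^sub>C Ld2) = ?e k *\<^sub>C v k" if "k \<in> F" for k
  proof -
    obtain a b where k: "k = (a, b)" by fastforce
    have w: "Ld1 * v k - v k * Ld1 = of_int a *\<^sub>C v k" "Ld2 * v k - v k * Ld2 = of_int b *\<^sub>C v k"
      using assms(2)[of a b] that by (simp_all add: k weight_def)
    have "(Ld1 + \<i> *\<^sub>C Ld2) * v k - v k * (Ld1 + \<i> *\<^sub>C Ld2)
        = (Ld1 * v k - v k * Ld1) + \<i> *\<^sub>C (Ld2 * v k - v k * Ld2)"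
      by (simp add: distrib_left distrib_right uloc_scaleC_mult_left uloc_scaleC_mult_right
          scaleC_diff_right)
    then show ?thesis using w by (simp add: k scaleC_add_left scaleC_scaleC)
  qed
qed

lemma weight0_proj_decomp:
  assumes "weight0_proj x y"
  shows "\<exists>F v. finite F \<and> (\<forall>a b. weight a b (v (a, b))) \<and> (\<forall>k. k \<notin> F \<longrightarrow> v k = 0) \<and>
    x = (\<Sum>k\<in>F. v k) \<and> y = (\<Sum>k\<in>F. v k * Ldel1_zpow (fst k) * Ldel2_zpow (snd k))"
  using assms
proof (induction rule: weight0_proj.induct)
  case (weight a b x)
  then show ?case
    by (intro exI[of _ "{(a, b)}"] exI[of _ "(\<lambda>_. 0)((a, b) := x)"]) auto
next
  case (add x y x' y')
  then obtain F v F' v' where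
    F: "finite F" "\<And>a b. weight a b (v (a, b))" "\<And>k. k \<notin> F \<Longrightarrow> v k = 0" "x = (\<Sum>k\<in>F. v k)"
      "y = (\<Sum>k\<in>F. v k * Ldel1_zpow (fst k) * Ldel2_zpow (snd k))"
    and F': "finite F'" "\<And>a b. weight a b (v' (a, b))" "\<And>k. k \<notin> F' \<Longrightarrow> v' k = 0" "x' = (\<Sum>k\<in>F'. v' k)"
      "y' = (\<Sum>k\<in>F'. v' k * Ldel1_zpow (fst k) * Ldel2_zpow (snd k))"
    by auto
  have xy: "x = (\<Sum>k\<in>F \<union> F'. v k)" "y = (\<Sum>k\<in>F \<union> F'. v k * Ldel1_zpow (fst k) * Ldel2_zpow (snd k))"
    unfolding F(4,5) using F(1,3) F'(1) by (auto intro!: sum.mono_neutral_left)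
  have xy': "x' = (\<Sum>k\<in>F \<union> F'. v' k)" "y' = (\<Sum>k\<in>F \<union> F'. v' k * Ldel1_zpow (fst k) * Ldel2_zpow (snd k))"
    unfolding F'(4,5) using F'(1,3) F(1) by (auto intro!: sum.mono_neutral_left)
  show ?case
  proof (intro exI conjI allI impI)
    show "finite (F \<union> F')" using F(1) F'(1) by simp
    show "weight a b (v (a, b) + v' (a, b))" for a b using F(2) F'(2) by (rule weight_add)
    show "v k + v' k = 0" if "k \<notin> F \<union> F'" for k using that F(3) F'(3) by simp
    show "x + x' = (\<Sum>k\<in>F \<union> F'. v k + v' k)"
      by (simp only: xy(1) xy'(1) sum.distrib)
    show "y + y' = (\<Sum>k\<in>F \<union> F'. (v k + v' k) * Ldel1_zpow (fst k) * Ldel2_zpow (snd k))"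
      by (simp only: xy(2) xy'(2) sum.distrib distrib_right)
  qed
qed

lemma weight0_proj_of_zero: "weight0_proj 0 y \<Longrightarrow> y = 0"
proof -
  assume "weight0_proj 0 y"
  from weight0_proj_decomp[OF this] obtain F v
    where F: "finite F" "\<And>a b. weight a b (v (a, b))" "(\<Sum>k\<in>F. v k) = 0"
    and y: "y = (\<Sum>k\<in>F. v k * Ldel1_zpow (fst k) * Ldel2_zpow (snd k))"
    by auto
  then have "v k = 0" if "k \<in> F" for k
    using weights_independent[OF F(1) F(2) F(3) that] by simp
  then show "y = 0" by (simp add: y)
qed

section \<open>The left ideal generated by the shifted partial derivatives\<close>

text \<open>This will be the kernel of the map onto \<open>Q\<^sub>1\<close>.\<close>
definition one_ideal :: "uloc set"
  where "one_ideal = {a * (Ldel1 - 1) + b * (Ldel2 - 1) | a b. True}"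

lemma one_ideal_iff: "x \<in> one_ideal \<longleftrightarrow> (\<exists>a b. x = a * (Ldel1 - 1) + b * (Ldel2 - 1))"
  by (simp add: one_ideal_def)

lemma one_ideal_add: "x \<in> one_ideal \<Longrightarrow> y \<in> one_ideal \<Longrightarrow> x + y \<in> one_ideal"
proof -
  assume "x \<in> one_ideal" "y \<in> one_ideal"
  then obtain a b c d where "x = a * (Ldel1 - 1) + b * (Ldel2 - 1)" "y = c * (Ldel1 - 1) + d * (Ldel2 - 1)"
    by (auto simp: one_ideal_iff)
  then have "x + y = (a + c) * (Ldel1 - 1) + (b + d) * (Ldel2 - 1)" by (simp add: distrib_right)
  then show ?thesis unfolding one_ideal_iff by blast
qed

lemma one_ideal_mult_left: "x \<in> one_ideal \<Longrightarrow> u * x \<in> one_ideal"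
proof -
  assume "x \<in> one_ideal"
  then obtain a b where "x = a * (Ldel1 - 1) + b * (Ldel2 - 1)" by (auto simp: one_ideal_iff)
  then have "u * x = (u * a) * (Ldel1 - 1) + (u * b) * (Ldel2 - 1)" by (simp add: distrib_left mult.assoc)
  then show ?thesis unfolding one_ideal_iff by blast
qed

lemma one_ideal_zero: "0 \<in> one_ideal"
  unfolding one_ideal_iff by (intro exI[of _ 0]) simp

lemma one_ideal_uminus: "x \<in> one_ideal \<Longrightarrow> - x \<in> one_ideal"
  using one_ideal_mult_left[of x "- 1"] by simp

lemma one_ideal_diff: "x \<in> one_ideal \<Longrightarrow> y \<in> one_ideal \<Longrightarrow> x - y \<in> one_ideal"
  using one_ideal_add[OF _ one_ideal_uminus] by fastforce

lemma one_ideal_scaleC: "x \<in> one_ideal \<Longrightarrow> c *\<^sub>C x \<in> one_ideal"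
  by (simp add: scaleC_uloc_def left_act_conv_mult one_ideal_mult_left)

lemma one_ideal_mult_right:
  assumes "x \<in> one_ideal" "z * Ldel1 = Ldel1 * z" "z * Ldel2 = Ldel2 * z"
  shows "x * z \<in> one_ideal"
proof -
  obtain a b where x: "x = a * (Ldel1 - 1) + b * (Ldel2 - 1)" using assms(1) by (auto simp: one_ideal_iff)
  have "(Ldel1 - 1) * z = z * (Ldel1 - 1)" "(Ldel2 - 1) * z = z * (Ldel2 - 1)"
    by (simp_all add: assms(2,3) left_diff_distrib right_diff_distrib)
  then have "x * z = (a * z) * (Ldel1 - 1) + (b * z) * (Ldel2 - 1)"
    by (simp add: x distrib_right mult.assoc)
  then show ?thesis unfolding one_ideal_iff by blast
qed

lemma one_ideal_Ldel: "x * Ldel1 - x \<in> one_ideal" "x * Ldel2 - x \<in> one_ideal"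
  unfolding one_ideal_iff
  by (rule exI[of _ x], rule exI[of _ 0], simp add: right_diff_distrib,
      rule exI[of _ 0], rule exI[of _ x], simp add: right_diff_distrib)

lemma one_ideal_Ldel_inv: "x * Ldel1_inv - x \<in> one_ideal" "x * Ldel2_inv - x \<in> one_ideal"
  using one_ideal_uminus[OF one_ideal_Ldel(1)[of "x * Ldel1_inv"]]
    one_ideal_uminus[OF one_ideal_Ldel(2)[of "x * Ldel2_inv"]]
  by (simp_all add: mult.assoc)

lemma one_ideal_zpow: "x * Ldel1_zpow k - x \<in> one_ideal" "x * Ldel2_zpow k - x \<in> one_ideal"
proof -
  have step: "x * (w * z) - x \<in> one_ideal"
    if "\<And>x. x * z - x \<in> one_ideal" "\<And>x. x * w - x \<in> one_ideal" for w z x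
    using one_ideal_add[OF that(1)[of "x * w"] that(2)[of x]] by (simp add: mult.assoc)
  have "\<forall>x. x * Ldel1_zpow k - x \<in> one_ideal"
    by (rule zpow_induct[where P = "\<lambda>k z. \<forall>x. x * z - x \<in> one_ideal"])
       (use step one_ideal_Ldel one_ideal_Ldel_inv in \<open>auto simp: one_ideal_zero\<close>)
  then show "x * Ldel1_zpow k - x \<in> one_ideal" ..
  have "\<forall>x. x * Ldel2_zpow k - x \<in> one_ideal"
    by (rule zpow_induct[where P = "\<lambda>k z. \<forall>x. x * z - x \<in> one_ideal"])
       (use step one_ideal_Ldel one_ideal_Ldel_inv in \<open>auto simp: one_ideal_zero\<close>)
  then show "x * Ldel2_zpow k - x \<in> one_ideal" ..
qed

lemma weight0_proj_one_ideal: "weight0_proj x y \<Longrightarrow> y - x \<in> one_ideal"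
proof (induction rule: weight0_proj.induct)
  case (weight a b x)
  from one_ideal_add[OF one_ideal_zpow(2)[of "x * Ldel1_zpow a" b] one_ideal_zpow(1)[of x a]]
  show ?case by simp
next
  case (add x y x' y')
  from one_ideal_add[OF add.IH] show ?case by (simp add: algebra_simps)
qed

lemma one_ideal_weight0_proj: "x \<in> one_ideal \<Longrightarrow> weight0_proj x 0"
proof -
  assume "x \<in> one_ideal"
  then obtain a b where x: "x = (a * Ldel1 - a) + (b * Ldel2 - b)"
    by (auto simp: one_ideal_iff right_diff_distrib)
  obtain y z where "weight0_proj a y" "weight0_proj b z" using weight0_proj_total by metis
  then have "weight0_proj ((a * Ldel1 - a) + (b * Ldel2 - b)) ((y - y) + (z - z))"
    by (intro weight0_proj.add weight0_proj_diff weight0_proj_mult_Ldel)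
  then show ?thesis by (simp add: x)
qed

text \<open>The left ideal is a complement of the weight zero subalgebra. On weight zero the projection
  is the identity, on the left ideal it is zero, so they intersect trivially; together they span
  because an element differs from its projection by an element of the left ideal.\<close>
lemma one_ideal_weight0: "x \<in> one_ideal \<Longrightarrow> weight 0 0 x \<Longrightarrow> x = 0"
  using weight0_proj_of_zero[of x] weight0_proj_diff[OF weight0_proj_self one_ideal_weight0_proj, of x x]
  by simp

section \<open>The induced module as a quotient of the ring of fractions\<close>

lemma Q1_tensor_balanced: "Q1_tensor (u * uea_incl r) z = Q1_tensor u (uea_char_one r * z)"
  by transfer (rule tensor_null.balanced)

lemma uea_incl_scalar: "uea_incl (c *\<^sub>C 1) = c *\<^sub>C 1"
  by (simp add: uea_incl_def uea_lift_hom[OF lie_to_assoc_hom_delta2_incl])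

lemma uea_char_one_scalar: "uea_char_one (c *\<^sub>C 1) = c"
  by (simp add: uea_char_one_def uea_lift_hom[OF lie_to_assoc_hom_char_one] scaleC_complex_def)

lemma Q1_tensor_scalar: "Q1_tensor u z = Q1_tensor (z *\<^sub>C u) 1"
  using Q1_tensor_balanced[of u "z *\<^sub>C 1" 1]
  by (simp add: uea_incl_scalar uea_char_one_scalar mult_scaleC_right)

lemma Q1_tensor_del: "Q1_tensor (u * Udel1) 1 = Q1_tensor u 1" "Q1_tensor (u * Udel2) 1 = Q1_tensor u 1"
  using Q1_tensor_balanced[of u "uea_of delta2_del1" 1] Q1_tensor_balanced[of u "uea_of delta2_del2" 1]
  by (simp_all add: uea_incl_of uea_char_one_del delta2_del1.rep_eq delta2_del2.rep_eq)

lemma Q1_tensor_del12: "Q1_tensor (u * del12 ^ n) 1 = Q1_tensor u 1"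
proof (induction n arbitrary: u)
  case (Suc n)
  have "Q1_tensor (u * del12 ^ Suc n) 1 = Q1_tensor (u * Udel1 * Udel2 * del12 ^ n) 1"
    by (simp add: del12_def mult.assoc)
  then show ?case by (simp only: Suc Q1_tensor_del)
qed simp

text \<open>The map \<open>r (\<partial>\<^sub>1\<partial>\<^sub>2)\<^sup>-\<^sup>n \<mapsto> r \<otimes> 1\<close>. It is well defined because \<open>\<partial>\<^sub>1\<partial>\<^sub>2\<close> fixes the generator \<open>1 \<otimes> 1\<close>,
  so that a representative may be chosen.\<close>
definition Q1_proj :: "uloc \<Rightarrow> Q1"
  where "Q1_proj x = Q1_tensor (fst (rep_uloc x)) 1"

lemma Q1_proj_rfrac: "Q1_proj (rfrac r n) = Q1_tensor r 1"
proof -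
  obtain s m where sm: "rep_uloc (rfrac r n) = (s, m)" by fastforce
  have "rfrac s m = abs_uloc (rep_uloc (rfrac r n))" unfolding sm by (simp add: rfrac.abs_eq)
  then have "rfrac s m = rfrac r n" by (simp add: Quotient3_abs_rep[OF Quotient3_uloc])
  then obtain k where "s * del12 ^ (n + k) = r * del12 ^ (m + k)" by (auto simp: rfrac_eq_iff)
  then show ?thesis by (metis Q1_proj_def Q1_tensor_del12 fst_conv sm)
qed

lemma Q1_proj_uloc_of: "Q1_proj (uloc_of u) = Q1_tensor u 1"
  by (simp add: uloc_of_def Q1_proj_rfrac)

lemma Q1_proj_add: "Q1_proj (x + y) = Q1_proj x + Q1_proj y"
  by (rule rfrac_common[of x y]) (simp add: rfrac_add Q1_proj_rfrac Q1_tensor_add_left)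

lemma Q1_proj_act: "Q1_proj (uloc_of u * x) = Q1_act u (Q1_proj x)"
  by (rule rfrac_cases[of x]) (simp add: Q1_proj_rfrac Q1_act_tensor left_act_rfrac flip: left_act_conv_mult)

lemma Q1_proj_scaleC: "Q1_proj (c *\<^sub>C x) = c *\<^sub>C Q1_proj x"
  by (simp add: scaleC_uloc_def left_act_conv_mult Q1_proj_act scaleC_Q1_def)

lemma Q1_proj_zero: "Q1_proj 0 = 0"
  using Q1_proj_add[of 0 0] by simp

lemma Q1_proj_diff: "Q1_proj (x - y) = Q1_proj x - Q1_proj y"
  using Q1_proj_add[of "x - y" y] by (simp add: algebra_simps)

lemma Q1_tensor_surj: "\<exists>u. q = Q1_tensor u 1"
proof (induction q rule: Q1_induct)
  case (tensor u z)
  show ?case using Q1_tensor_scalar by blast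
next
  case zero
  show ?case using Q1_proj_uloc_of[of 0] by (auto simp: Q1_proj_zero intro: exI[of _ 0])
next
  case (diff x y)
  then obtain u v where "x = Q1_tensor u 1" "y = Q1_tensor v 1" by blast
  then have "x - y = Q1_tensor (u - v) 1"
    by (simp add: uloc_of_diff Q1_proj_diff flip: Q1_proj_uloc_of)
  then show ?case ..
qed

lemma Q1_proj_surj: "\<exists>u. q = Q1_proj (uloc_of u)"
  using Q1_tensor_surj by (simp add: Q1_proj_uloc_of)

lemma Ldel_commute_del12_inv: "del12_inv * Ldel1 = Ldel1 * del12_inv" "del12_inv * Ldel2 = Ldel2 * del12_inv"
proof -
  have "del12_inv * Ldel1 = Ldel1_inv * Ldel1 * Ldel2_inv"
    by (simp only: del12_inv_conv mult.assoc Ldel_commute_inv(1))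
  then show "del12_inv * Ldel1 = Ldel1 * del12_inv" by (simp add: Ldel2_inv_def)
  have "del12_inv * Ldel2 = Ldel1_inv" by (simp add: del12_inv_conv mult.assoc)
  then show "del12_inv * Ldel2 = Ldel2 * del12_inv" by (simp add: Ldel1_inv_def)
qed

lemma Ldel_commute_del12_inv_power: "del12_inv ^ n * Ldel1 = Ldel1 * del12_inv ^ n" "del12_inv ^ n * Ldel2 = Ldel2 * del12_inv ^ n"
  using Ldel_commute_del12_inv by (simp_all add: power_commuting_commutes)

lemma Q1_proj_mult_Ldel: "Q1_proj (x * Ldel1) = Q1_proj x" "Q1_proj (x * Ldel2) = Q1_proj x"
proof -
  obtain r n where x: "x = rfrac r n" by (rule rfrac_cases)
  have "x * Ldel1 = rfrac (r * Udel1) n" "x * Ldel2 = rfrac (r * Udel2) n"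
    by (simp_all add: x rfrac_conv_mult uloc_of_mult mult.assoc Ldel_commute_del12_inv_power)
  then show "Q1_proj (x * Ldel1) = Q1_proj x" "Q1_proj (x * Ldel2) = Q1_proj x"
    by (simp_all add: x Q1_proj_rfrac Q1_tensor_del)
qed

text \<open>The linear extension of \<open>f\<close> to the free abelian group, used to map the tensor relations into the
  ring of fractions.\<close>
definition frag_eval :: "('a \<Rightarrow> 'b::complex_vector) \<Rightarrow> ('a \<Rightarrow>\<^sub>0 int) \<Rightarrow> 'b"
  where "frag_eval f p = (\<Sum>k\<in>Poly_Mapping.keys p. of_int (Poly_Mapping.lookup p k) *\<^sub>C f k)"

lemma frag_eval_superset:
  assumes "finite A" "Poly_Mapping.keys p \<subseteq> A"
  shows "frag_eval f p = (\<Sum>k\<in>A. of_int (Poly_Mapping.lookup p k) *\<^sub>C f k)"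
  unfolding frag_eval_def using assms
  by (intro sum.mono_neutral_left) (auto simp: in_keys_iff)

lemma frag_eval_diff: "frag_eval f (p - q) = frag_eval f p - frag_eval f q"
proof -
  let ?A = "Poly_Mapping.keys p \<union> Poly_Mapping.keys q"
  have "Poly_Mapping.keys (p - q) \<subseteq> ?A" by (rule keys_diff)
  then show ?thesis
    by (simp add: frag_eval_superset[of ?A] lookup_minus scaleC_diff_left sum_subtractf)
qed

lemma frag_eval_zero [simp]: "frag_eval f 0 = 0"
  by (simp add: frag_eval_def)

lemma frag_eval_of [simp]: "frag_eval f (frag_of k) = f k"
  by (simp add: frag_eval_def scaleC_one)

lemma delta2_span: obtains a b where "x = a *\<^sub>C delta2_del1 + b *\<^sub>C delta2_del2"
proof -
  obtain a b where "delta2_incl x = a *\<^sub>C del1 + b *\<^sub>C del2"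
    using delta2_incl[of x] by auto
  then have "x = a *\<^sub>C delta2_del1 + b *\<^sub>C delta2_del2"
    by (simp add: delta2_incl_inject[symmetric] plus_delta2.rep_eq scaleC_delta2.rep_eq
        delta2_del1.rep_eq delta2_del2.rep_eq)
  then show ?thesis by (rule that)
qed

lemma one_ideal_balanced: "uloc_of (uea_incl r) - uea_char_one r *\<^sub>C 1 \<in> one_ideal"
proof (induction r rule: uea_induct)
  case (const c)
  show ?case
    by (simp add: uea_incl_scalar uea_char_one_scalar uloc_of_scaleC one_ideal_zero)
next
  case (of x)
  obtain a b where x: "x = a *\<^sub>C delta2_del1 + b *\<^sub>C delta2_del2" by (rule delta2_span)
  have "char_one x = a + b"
    using lie_to_assoc_hom_char_one
    by (simp add: x lie_to_assoc_hom_def char_one_del scaleC_complex_def)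
  moreover have "uloc_of (uea_incl (uea_of x)) = a *\<^sub>C Ldel1 + b *\<^sub>C Ldel2"
    unfolding uea_incl_of by (simp add: x plus_delta2.rep_eq scaleC_delta2.rep_eq
        delta2_del1.rep_eq delta2_del2.rep_eq uea_of_add uea_of_scaleC uloc_of_add uloc_of_scaleC)
  ultimately have "uloc_of (uea_incl (uea_of x)) - uea_char_one (uea_of x) *\<^sub>C 1
      = a *\<^sub>C (1 * Ldel1 - 1) + b *\<^sub>C (1 * Ldel2 - 1)"
    by (simp add: uea_char_one_def uea_lift_of[OF lie_to_assoc_hom_char_one] scaleC_add_left
        scaleC_diff_right)
  then show ?case
    using one_ideal_Ldel by (simp add: one_ideal_add one_ideal_scaleC del: mult_1)
next
  case (add u v)
  have "uloc_of (uea_incl (u + v)) - uea_char_one (u + v) *\<^sub>C 1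
      = (uloc_of (uea_incl u) - uea_char_one u *\<^sub>C 1) + (uloc_of (uea_incl v) - uea_char_one v *\<^sub>C 1)"
    by (simp add: uea_incl_def uea_char_one_def uea_lift_hom[OF lie_to_assoc_hom_delta2_incl]
        uea_lift_hom[OF lie_to_assoc_hom_char_one] scaleC_add_left uloc_of_add)
  then show ?case using add by (simp add: one_ideal_add)
next
  case (mult u v)
  let ?i = "\<lambda>r. uloc_of (uea_incl r)" and ?c = uea_char_one
  have "?i (u * v) - ?c (u * v) *\<^sub>C 1 = ?i u * (?i v - ?c v *\<^sub>C 1) + ?c v *\<^sub>C (?i u - ?c u *\<^sub>C 1)"
    by (simp add: uea_incl_def uea_char_one_def uea_lift_hom[OF lie_to_assoc_hom_delta2_incl]
        uea_lift_hom[OF lie_to_assoc_hom_char_one] uloc_of_mult right_diff_distrib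
        uloc_scaleC_mult_right scaleC_diff_right scaleC_scaleC mult.commute)
  then show ?case
    using mult by (simp only:) (intro one_ideal_add one_ideal_mult_left one_ideal_scaleC)
qed

lemma Q1_null_one_ideal:
  assumes "x \<in> Q1_null"
  shows "frag_eval (\<lambda>(u, z). z *\<^sub>C uloc_of u) x \<in> one_ideal"
  using assms
proof induction
  case (balanced m r n)
  have "n *\<^sub>C uloc_of (m * uea_incl r) - (uea_char_one r * n) *\<^sub>C uloc_of m
      = n *\<^sub>C (uloc_of m * (uloc_of (uea_incl r) - uea_char_one r *\<^sub>C 1))"
    by (simp add: uloc_of_mult right_diff_distrib uloc_scaleC_mult_right scaleC_diff_right
        scaleC_scaleC mult.commute)
  then show ?case
    by (simp add: frag_eval_diff one_ideal_scaleC one_ideal_mult_left one_ideal_balanced)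
qed (simp_all add: frag_eval_diff one_ideal_zero one_ideal_diff uloc_of_add scaleC_add_left scaleC_add_right)

text \<open>The relations of the tensor product map into the left ideal, so an element that dies in \<open>Q\<^sub>1\<close>
  has its numerator in the left ideal; and the left ideal is stable under right multiplication by
  \<open>(\<partial>\<^sub>1\<partial>\<^sub>2)\<^sup>-\<^sup>1\<close>, which commutes with its generators.\<close>
lemma Q1_proj_eq_0_iff: "Q1_proj x = 0 \<longleftrightarrow> x \<in> one_ideal"
proof
  assume 0: "Q1_proj x = 0"
  obtain r n where x: "x = rfrac r n" by (rule rfrac_cases)
  have "Q1_tensor r 1 = 0" using 0 by (simp add: x Q1_proj_rfrac)
  then have "frag_of (r, 1) - 0 \<in> Q1_null"
    by transfer
  then have "uloc_of r \<in> one_ideal"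
    using Q1_null_one_ideal by (fastforce simp: scaleC_one)
  then show "x \<in> one_ideal"
    unfolding x rfrac_conv_mult
    by (rule one_ideal_mult_right) (simp_all add: Ldel_commute_del12_inv_power)
next
  assume "x \<in> one_ideal"
  then obtain a b where "x = (a * Ldel1 - a) + (b * Ldel2 - b)"
    by (auto simp: one_ideal_iff right_diff_distrib)
  then show "Q1_proj x = 0" by (simp add: Q1_proj_add Q1_proj_diff Q1_proj_mult_Ldel)
qed

lemma Q1_proj_weight0_inj:
  assumes "weight 0 0 x" "weight 0 0 y" "Q1_proj x = Q1_proj y"
  shows "x = y"
proof -
  have "weight 0 0 (x - y)" using weight_add[OF assms(1) weight_uminus[OF assms(2)]] by simp
  then show ?thesis
    using one_ideal_weight0[of "x - y"] assms(3) by (simp add: Q1_proj_diff flip: Q1_proj_eq_0_iff)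
qed

lemma Q1_proj_weight0_surj: "\<exists>x. weight 0 0 x \<and> Q1_proj x = q"
proof -
  obtain u where q: "q = Q1_proj (uloc_of u)" using Q1_proj_surj by blast
  obtain y where y: "weight0_proj (uloc_of u) y" using weight0_proj_total by blast
  then have "Q1_proj (y - uloc_of u) = 0"
    using weight0_proj_one_ideal by (simp add: Q1_proj_eq_0_iff)
  then show ?thesis using weight0_proj_weight[OF y] by (auto simp: Q1_proj_diff q)
qed

section \<open>Endomorphisms of the induced module as right multiplications\<close>

lemma uloc_centralizer_iff:
  "x \<in> uloc_centralizer \<longleftrightarrow> x * Ldel1 = Ldel1 * x \<and> x * Ldel2 = Ldel2 * x \<and> weight 0 0 x"
  by (auto simp: uloc_centralizer_def weight_def)

text \<open>Right multiplication by \<open>x\<close>, transported to \<open>Q\<^sub>1\<close> through an arbitrary preimage. It is independent of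
  the preimage for \<open>x\<close> commuting with \<open>\<partial>\<^sub>1, \<partial>\<^sub>2\<close>, as the left ideal is then stable under right
  multiplication by \<open>x\<close>.\<close>
definition right_mult_Q1 :: "uloc \<Rightarrow> Q1 \<Rightarrow> Q1"
  where "right_mult_Q1 x q = Q1_proj ((SOME y. Q1_proj y = q) * x)"

lemma right_mult_Q1_proj:
  assumes "x \<in> uloc_centralizer"
  shows "right_mult_Q1 x (Q1_proj y) = Q1_proj (y * x)"
proof -
  define z where "z = (SOME z. Q1_proj z = Q1_proj y)"
  have "Q1_proj z = Q1_proj y" unfolding z_def by (rule someI) (rule refl)
  then have "z - y \<in> one_ideal" by (simp add: Q1_proj_diff flip: Q1_proj_eq_0_iff)
  then have "(z - y) * x \<in> one_ideal"
    using assms by (intro one_ideal_mult_right) (simp_all add: uloc_centralizer_iff)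
  then show ?thesis
    by (simp add: right_mult_Q1_def left_diff_distrib Q1_proj_diff flip: Q1_proj_eq_0_iff z_def)
qed

lemma Q1_proj_cases: obtains y where "q = Q1_proj y"
  using Q1_proj_surj by blast

lemma right_mult_Q1_carrier:
  assumes x: "x \<in> uloc_centralizer"
  shows "right_mult_Q1 x \<in> carrier H1"
proof -
  have "right_mult_Q1 x (p + q) = right_mult_Q1 x p + right_mult_Q1 x q" for p q
    by (rule Q1_proj_cases[of p], rule Q1_proj_cases[of q])
       (simp add: right_mult_Q1_proj[OF x] distrib_right Q1_proj_add flip: Q1_proj_add)
  moreover have "right_mult_Q1 x (c *\<^sub>C q) = c *\<^sub>C right_mult_Q1 x q" for c q
    by (rule Q1_proj_cases[of q])
       (simp add: right_mult_Q1_proj[OF x] uloc_scaleC_mult_left flip: Q1_proj_scaleC)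
  moreover have "right_mult_Q1 x (Q1_act u q) = Q1_act u (right_mult_Q1 x q)" for u q
    by (rule Q1_proj_cases[of q])
       (simp add: right_mult_Q1_proj[OF x] mult.assoc flip: Q1_proj_act)
  ultimately show ?thesis by (simp add: H1_def)
qed

lemma H1_carrier_act:
  assumes "f \<in> carrier H1"
  shows "f (Q1_act u q) = Q1_act u (f q)"
proof (induction u arbitrary: q rule: uea_induct)
  case (const c)
  then show ?case using assms by (simp add: H1_def flip: scaleC_Q1_def)
next
  case (of x)
  then show ?case using assms by (simp add: H1_def)
next
  case (add u v)
  then show ?case using assms by (simp add: H1_def Q1_act_add_left)
next
  case (mult u v)
  then show ?case by (simp add: Q1_act_mult)
qed

lemma right_mult_Q1_inj:
  assumes "x \<in> uloc_centralizer" "y \<in> uloc_centralizer" "right_mult_Q1 x = right_mult_Q1 y"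
  shows "x = y"
proof -
  have "Q1_proj x = Q1_proj y"
    using right_mult_Q1_proj[OF assms(1), of 1] right_mult_Q1_proj[OF assms(2), of 1] assms(3) by simp
  then show ?thesis
    using assms(1,2) by (intro Q1_proj_weight0_inj) (simp_all add: uloc_centralizer_iff)
qed

text \<open>An endomorphism \<open>f\<close> is determined by the image of the generator, which lifts to a unique \<open>x\<close> of weight
  zero. As the generator is fixed by \<open>\<partial>\<^sub>i\<close>, so is its image; hence \<open>\<partial>\<^sub>i x \<partial>\<^sub>i\<^sup>-\<^sup>1\<close>, which is also of
  weight zero, has the same image as \<open>x\<close> and therefore equals \<open>x\<close>.\<close>
lemma right_mult_Q1_surj:
  assumes f: "f \<in> carrier H1"
  shows "\<exists>x\<in>uloc_centralizer. right_mult_Q1 x = f"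
proof -
  obtain x where x: "weight 0 0 x" "Q1_proj x = f (Q1_proj 1)" using Q1_proj_weight0_surj by blast
  have whittaker: "Q1_act Udel1 (Q1_proj x) = Q1_proj x" "Q1_act Udel2 (Q1_proj x) = Q1_proj x"
    using Q1_proj_mult_Ldel[of 1] Q1_proj_act[of _ 1]
    by (simp_all add: x(2) flip: H1_carrier_act[OF f])
  have commute: "x * e = e * x" if "e = uloc_of d" "Q1_act d (Q1_proj x) = Q1_proj x"
    "weight a b e" "e * e' = 1" "e' * e = 1" "\<And>y. Q1_proj (y * e) = Q1_proj y" for e d e' a b
  proof -
    have "weight (a + 0 + - a) (b + 0 + - b) (e * x * e')"
      by (intro weight_mult that x weight_inverse[of _ _ e])
    moreover have "Q1_proj (e * x * e') = Q1_proj (e * x * (e' * e))"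
      by (simp only: that(6) flip: mult.assoc)
    then have "Q1_proj (e * x * e') = Q1_proj x"
      by (simp only: that(5) mult_1_right) (simp only: that(1,2) Q1_proj_act)
    ultimately have "e * x * e' = x"
      using x(1) by (intro Q1_proj_weight0_inj) simp_all
    then show ?thesis by (metis mult.assoc mult_1_right that(5))
  qed
  have "x * Ldel1 = Ldel1 * x"
    by (rule commute[OF refl whittaker(1) weight_Ldel(1) Ldel_inv(1,3) Q1_proj_mult_Ldel(1)])
  moreover have "x * Ldel2 = Ldel2 * x"
    by (rule commute[OF refl whittaker(2) weight_Ldel(2) Ldel_inv(2,4) Q1_proj_mult_Ldel(2)])
  ultimately have xc: "x \<in> uloc_centralizer" using x(1) by (simp add: uloc_centralizer_iff)
  have "right_mult_Q1 x q = f q" for q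
  proof -
    obtain u where q: "q = Q1_proj (uloc_of u)" using Q1_proj_surj by blast
    have "f q = Q1_act u (f (Q1_proj 1))"
      using Q1_proj_act[of u 1] by (simp add: q H1_carrier_act[OF f])
    then show ?thesis by (simp add: q right_mult_Q1_proj[OF xc] Q1_proj_act x(2))
  qed
  with xc show ?thesis by blast
qed

definition H_to_H1 :: "(sbar2 uea \<times> sbar2 uea) set \<Rightarrow> Q1 \<Rightarrow> Q1"
  where "H_to_H1 X = right_mult_Q1 (the_inv frac_class X)"

lemma H_to_H1: "H_to_H1 (frac_class x) = right_mult_Q1 x"
  by (simp add: H_to_H1_def the_inv_f_f inj_def frac_class_inj)

lemma uloc_centralizer_closed:
  assumes "x \<in> uloc_centralizer" "y \<in> uloc_centralizer"
  shows "x * y \<in> uloc_centralizer" "x + y \<in> uloc_centralizer" "c *\<^sub>C x \<in> uloc_centralizer"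
proof -
  have "x * y * e = e * (x * y)" if "x * e = e * x" "y * e = e * y" for e
    using that by (metis mult.assoc)
  then show "x * y \<in> uloc_centralizer" using assms by (simp add: uloc_centralizer_def)
  show "x + y \<in> uloc_centralizer" using assms by (simp add: uloc_centralizer_def distrib_left distrib_right)
  show "c *\<^sub>C x \<in> uloc_centralizer"
    using assms by (simp add: uloc_centralizer_def uloc_scaleC_mult_left uloc_scaleC_mult_right)
qed

lemma uloc_centralizer_one: "1 \<in> uloc_centralizer"
  by (simp add: uloc_centralizer_def)

lemma right_mult_Q1_eqI:
  assumes "x \<in> uloc_centralizer" "\<And>y. Q1_proj (y * x) = f (Q1_proj y)"
  shows "right_mult_Q1 x = f"
proof
  fix q
  show "right_mult_Q1 x q = f q"
    by (rule Q1_proj_cases[of q]) (simp add: right_mult_Q1_proj assms)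
qed

theorem theorem5p5:
  shows "\<exists>\<Phi> \<in> ring_iso H H1. \<forall>c. \<forall>u \<in> carrier H. \<Phi> (c \<odot>\<^bsub>H\<^esub> u) = c \<odot>\<^bsub>H1\<^esub> \<Phi> u"
proof (intro bexI[of _ H_to_H1] allI ballI)
  fix c X assume "X \<in> carrier H"
  then obtain x where x: "X = frac_class x" "x \<in> uloc_centralizer" by (auto simp: H_carrier)
  have "right_mult_Q1 (c *\<^sub>C x) = (\<lambda>q. c *\<^sub>C right_mult_Q1 x q)"
    by (rule right_mult_Q1_eqI)
       (simp_all add: x uloc_centralizer_closed[OF _ uloc_centralizer_one] right_mult_Q1_proj uloc_scaleC_mult_right Q1_proj_scaleC)
  then show "H_to_H1 (c \<odot>\<^bsub>H\<^esub> X) = c \<odot>\<^bsub>H1\<^esub> H_to_H1 X"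
    by (simp add: x H_ops H_to_H1 H1_def)
next
  show "H_to_H1 \<in> ring_iso H H1"
    unfolding ring_iso_def
  proof (intro CollectI conjI ring_hom_memI)
    fix X assume "X \<in> carrier H"
    then obtain x where x: "X = frac_class x" "x \<in> uloc_centralizer" by (auto simp: H_carrier)
    show "H_to_H1 X \<in> carrier H1" by (simp add: x H_to_H1 right_mult_Q1_carrier)
    fix Y assume "Y \<in> carrier H"
    then obtain y where y: "Y = frac_class y" "y \<in> uloc_centralizer" by (auto simp: H_carrier)
    have "right_mult_Q1 (x * y) = right_mult_Q1 y \<circ> right_mult_Q1 x"
      by (rule right_mult_Q1_eqI)
         (simp_all add: x y uloc_centralizer_closed right_mult_Q1_proj mult.assoc)
    then show "H_to_H1 (X \<otimes>\<^bsub>H\<^esub> Y) = H_to_H1 X \<otimes>\<^bsub>H1\<^esub> H_to_H1 Y"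
      by (simp add: x y H_ops H_to_H1 H1_def)
    have "right_mult_Q1 (x + y) = (\<lambda>q. right_mult_Q1 x q + right_mult_Q1 y q)"
      by (rule right_mult_Q1_eqI)
         (simp_all add: x y uloc_centralizer_closed right_mult_Q1_proj distrib_left Q1_proj_add)
    then show "H_to_H1 (X \<oplus>\<^bsub>H\<^esub> Y) = H_to_H1 X \<oplus>\<^bsub>H1\<^esub> H_to_H1 Y"
      by (simp add: x y H_ops H_to_H1 H1_def)
  next
    have "right_mult_Q1 1 = id"
      by (rule right_mult_Q1_eqI) (simp_all add: uloc_centralizer_one)
    then show "H_to_H1 \<one>\<^bsub>H\<^esub> = \<one>\<^bsub>H1\<^esub>" by (simp add: H_ops H_to_H1 H1_def)
  next
    show "bij_betw H_to_H1 (carrier H) (carrier H1)"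
      unfolding bij_betw_def
    proof
      show "inj_on H_to_H1 (carrier H)"
        by (rule inj_onI) (auto simp: H_carrier H_to_H1 frac_class_inj dest: right_mult_Q1_inj)
      show "H_to_H1 ` carrier H = carrier H1"
        using right_mult_Q1_carrier right_mult_Q1_surj
        by (auto simp: H_carrier H_to_H1 image_image)
    qed
  qed
qed

end
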